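(* Suppose Assumptions 1 and 2 (listed in the context) hold, and let $\{w^k\}_{k\ge 0}=\{(u^k,v^k,p^k)\}_{k\ge0}$ be a sequence generated by the algorithm NAPP-AL (described in the context) where at every iteration $k$ one sets $$\delta_k := \beta \left(L_G+\|q^k\|L_{\Omega}+\gamma (L^0_{\Theta})^2+\frac{14\gamma\|B\|^2(L^0_{\Theta})^2}{\lambda_{\min}(B^{\top}B)}+\frac{14(L_G+\gamma\|B\| L^0_{\Theta})^2}{\gamma\lambda_{\min}(B^{\top}B)}+1\right)^{-1}.$$ For $k\ge 1$ define $$\Lambda^k := \mathcal{L}_{\gamma}(u^k,v^k,p^k)+c_1 \|u^{k-1}-u^k\|^2+c_2 \|v^{k-1}-v^{k}\|^2+\frac{1}{2\gamma}\|p^{k-1}-p^k\|^2,$$ with $c_1:=\frac{7(L_G+\gamma\|B\|L^0_{\Theta})^2}{\gamma\lambda_{\min}(B^{\top}B)}$ and $c_2:=\frac{7(L_G+L_H)^2}{\gamma\lambda_{\min}(B^{\top}B)}$. Then: (i) $\{\Lambda^k\}$ is bounded below and there is $\Lambda^*\in\mathbf{R}$ with $\lim_{k\to\infty}\Lambda^k=\Lambda^*$; (ii) $\{w^k\}$ is bounded and $\|w^k-w^{k+1}\|\to 0$; (iii) the sequences $\{\mathcal{L}_{\gamma}(w^k)\}$ and $\{F(u^k,v^k)\}$ both converge to $\Lambda^*$, and $\lim_{k\to\infty}\left(\Theta(u^k)+Bv^k\right)=0$; (iv) there exists $c_5>0$ such that ${\rm dist}\left(0,\partial\mathcal{L}_{\gamma}(w^{k+1})\right)\le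 c_5\|w^k-w^{k+1}\|$ for all $k$ (hence ${\rm dist}\left(0,\partial\mathcal{L}_{\gamma}(w^{k})\right)\to 0$); (v) any cluster point $\bar w$ of $\{w^k\}$ is a stationary point of (P), and $\mathcal{L}_{\gamma}(\bar w)=\Lambda^*$.
   Context: Problem (P): minimize $F(u,v):=G(u,v)+J(u)+H(v)$ subject to $\Theta(u)+Bv=0$, $u\in\mathbf{U}$, $v\in\mathbf{R}^d$, where $\mathbf{U}\subseteq\mathbf{R}^n$ is nonempty, closed and convex, $\Theta=\Omega+\Phi:\mathbf{R}^n\to\mathbf{R}^m$ with $\Omega,\Phi$ differentiable, and $B\in\mathbf{R}^{m\times d}$. $\|\cdot\|$ is the Euclidean norm (spectral norm for matrices), $\lambda_{\min}$ the smallest eigenvalue, and ${\rm dist}(x,\mathbf{C})=\inf\{\|x-z\|:z\in \mathbf{C}\}$ ($+\infty$ if $\mathbf{C}=\emptyset$). Assumption 1. (H1) $G:\mathbf{R}^n\times\mathbf{R}^d\to\mathbf{R}$ is differentiable (possibly nonconvex) with $L_G$-Lipschitz gradient. (H2) $H:\mathbf{R}^d\to\mathbf{R}$ is differentiable (possibly nonconvex) with $L_H$-Lipschitz gradient. (H3) $J:\mathbf{R}^n\to(-\infty,+\infty]$ is proper and lower semicontinuous (possibly nonconvex); if $\mathbf{U}=\mathbf{R}^n$, ${\rm dom}(J)$ is convex; if $\mathbf{U}\neq\mathbf{R}^n$, $J$ is locally Lipschitz continuous around every point of ${\rm dom}(J)\cap\mathbf{U}$. (H4) $\|\Theta(u)-\Theta(u')\|\le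 L^0_\Theta\|u-u'\|$ for all $u,u'$. (H5) $\Omega=(\Omega_1,\dots,\Omega_m)^\top$ where each $\Omega_j:\mathbf{R}^n\to\mathbf{R}$ has $L_{\Omega_j}$-Lipschitz gradient; $L_\Omega:=\sum_{j=1}^m L_{\Omega_j}$. (H6) $B$ is a tall matrix of full column rank and ${\rm Im}(\Theta)\subseteq{\rm Im}(B)$. (H7) $F$ is bounded below and coercive over $\{(u,v)\in\mathbf{R}^n\times\mathbf{R}^d:\Theta(u)+Bv=0\}$ (coercive: $F(u,v)\to+\infty$ as $\|(u,v)\|\to\infty$ within this set). Assumption 2. (i) $K:\mathbf{R}^n\to\mathbf{R}$ is differentiable, $\beta$-strongly convex ($\beta>0$), with $L_K$-Lipschitz gradient. (ii) $\gamma>\frac{\sqrt{57}+1}{2\lambda_{\min}(B^\top B)}(L_G+L_H)$ (and $\gamma>0$). Bregman distance: $D(u,u')=K(u)-K(u')-\langle\nabla K(u'),u-u'\rangle$. Algorithm NAPP-AL. Fix $\sigma\in(0,1)$ and start from $u^0\in\mathbf{R}^n,v^0\in\mathbf{R}^d,p^0\in\mathbf{R}^m$. For $k=0,1,2,\dots$: set $q^k=p^k+\gamma(\Theta(u^k)+Bv^k)$, take $\delta_k>0$ and $\epsilon^k$ with $\sigma\delta_k\le\epsilon^k\le\delta_k$, and let $$u^{k+1}\in\arg\min_{u\in\mathbf{U}}\ \langle\nabla_uG(u^k,v^k),u\rangle+J(u)+\langle q^k,\nabla\Omega(u^k)u+\Phi(u)\rangle+\tfrac1{\epsilon^k}D(u,u^k),$$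 $$v^{k+1}=\arg\min_{v\in\mathbf{R}^d}\ \langle\nabla_vG(u^k,v^k)+\nabla H(v^k),v\rangle+\langle q^k,Bv\rangle+\tfrac\gamma2\|B(v-v^k)\|^2,$$ $$p^{k+1}=p^k+\gamma(\Theta(u^{k+1})+Bv^{k+1}).$$ The $u$-subproblem is assumed to be solved to global optimality (a global minimizer is assumed to exist). Write $w^k=(u^k,v^k,p^k)$. Augmented Lagrangian: for $w=(u,v,p)$, $\mathcal{L}_\gamma(w)=F(u,v)+\langle p,\Theta(u)+Bv\rangle+\frac\gamma2\|\Theta(u)+Bv\|^2$. For $w\in\mathbf{U}\times\mathbf{R}^d\times\mathbf{R}^m$, $\partial\mathcal{L}_\gamma(w)$ denotes the product of the three sets $\nabla_uG(u,v)+\partial J(u)+\mathcal{N}_{\mathbf{U}}(u)+(\nabla\Theta(u))^\top[p+\gamma(\Theta(u)+Bv)]$, $\{\nabla_vG(u,v)+\nabla H(v)+B^\top[p+\gamma(\Theta(u)+Bv)]\}$, $\{\Theta(u)+Bv\}$, where $\partial J$ is the limiting (Mordukhovich) subdifferential and $\mathcal{N}_{\mathbf{U}}(u)=\{\xi:\langle\xi,\zeta-u\rangle\le0\ \forall\zeta\in\mathbf{U}\}$. A point $w\in\mathbf{U}\times\mathbf{R}^d\times\mathbf{R}^m$ is a stationary point of (P) if $0\in\partial\mathcal{L}_\gamma(w)$ (equivalently, the KKT conditions hold: $0\in\nabla_uG(u,v)+\partial J(u)+\mathcal{N}_{\mathbf{U}}(u)+(\nabla\Theta(u))^\top p$, $0=\nabla_vG(u,v)+\nabla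 H(v)+B^\top p$, $\Theta(u)+Bv=0$). *)

theory Defs
  imports "HOL-Analysis.Analysis"
begin

section \<open>Smooth and nonsmooth calculus\<close>

definition grad :: "('a::real_inner \<Rightarrow> real) \<Rightarrow> 'a \<Rightarrow> 'a" where
  "grad f x = (THE D. GDERIV f x :> D)"

definition grad_fst :: "('a::real_inner \<times> 'b::real_inner \<Rightarrow> real) \<Rightarrow> 'a \<Rightarrow> 'b \<Rightarrow> 'a" where
  "grad_fst f x y = grad (\<lambda>x'. f (x', y)) x"

definition grad_snd :: "('a::real_inner \<times> 'b::real_inner \<Rightarrow> real) \<Rightarrow> 'a \<Rightarrow> 'b \<Rightarrow> 'b" where
  "grad_snd f x y = grad (\<lambda>y'. f (x, y')) y"

definition strongly_convex :: "real \<Rightarrow> ('a::real_normed_vector \<Rightarrow> real) \<Rightarrow> bool" where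
  "strongly_convex \<beta> K \<longleftrightarrow>
     (\<forall>x y. \<forall>t\<in>{0..1}. K (t *\<^sub>R x + (1 - t) *\<^sub>R y)
        \<le> t * K x + (1 - t) * K y - \<beta> / 2 * t * (1 - t) * (norm (x - y))\<^sup>2)"

definition bregman :: "('a::real_inner \<Rightarrow> real) \<Rightarrow> 'a \<Rightarrow> 'a \<Rightarrow> real" where
  "bregman K x x' = K x - K x' - grad K x' \<bullet> (x - x')"

definition edom :: "('a \<Rightarrow> ereal) \<Rightarrow> 'a set" where
  "edom J = {x. J x < \<infinity>}"

definition proper_ereal :: "('a \<Rightarrow> ereal) \<Rightarrow> bool" where
  "proper_ereal J \<longleftrightarrow> (\<forall>x. J x \<noteq> - \<infinity>) \<and> edom J \<noteq> {}"

definition lower_semicontinuous :: "('a::topological_space \<Rightarrow> ereal) \<Rightarrow> bool" where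
  "lower_semicontinuous J \<longleftrightarrow> (\<forall>x. J x \<le> Liminf (at x) J)"

text \<open>In particular the function is finite on a full neighbourhood of the point.\<close>

definition lipschitz_around :: "('a::metric_space \<Rightarrow> ereal) \<Rightarrow> 'a \<Rightarrow> bool" where
  "lipschitz_around J x \<longleftrightarrow>
     (\<exists>e>0. \<exists>L. (\<forall>y\<in>ball x e. \<bar>J y\<bar> \<noteq> \<infinity>) \<and> L-lipschitz_on (ball x e) (\<lambda>y. real_of_ereal (J y)))"

definition frechet_subdifferential :: "('a::real_inner \<Rightarrow> ereal) \<Rightarrow> 'a \<Rightarrow> 'a set" where
  "frechet_subdifferential J x =
     {\<xi>. \<bar>J x\<bar> \<noteq> \<infinity> \<and>
         0 \<le> Liminf (at x) (\<lambda>y. (J y - J x - ereal (\<xi> \<bullet> (y - x))) / ereal (norm (y - x)))}"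

definition limiting_subdifferential :: "('a::real_inner \<Rightarrow> ereal) \<Rightarrow> 'a \<Rightarrow> 'a set" where
  "limiting_subdifferential J x =
     {\<xi>. \<bar>J x\<bar> \<noteq> \<infinity> \<and>
         (\<exists>X \<Xi>. X \<longlonglongrightarrow> x \<and> (\<lambda>k. J (X k)) \<longlonglongrightarrow> J x \<and>
                (\<forall>k. \<Xi> k \<in> frechet_subdifferential J (X k)) \<and> \<Xi> \<longlonglongrightarrow> \<xi>)}"

definition normal_cone :: "'a::real_inner set \<Rightarrow> 'a \<Rightarrow> 'a set" where
  "normal_cone U x = {\<xi>. \<forall>\<zeta>\<in>U. \<xi> \<bullet> (\<zeta> - x) \<le> 0}"

text \<open>Unlike \<^const>\<open>infdist\<close>, the distance to the empty set is \<open>\<infinity>\<close>.\<close>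

definition edist_set :: "'a::real_normed_vector \<Rightarrow> 'a set \<Rightarrow> ereal" where
  "edist_set x C = (INF z\<in>C. ereal (norm (x - z)))"

section \<open>Matrices\<close>

definition real_eigenvalue :: "real^'n^'n \<Rightarrow> real \<Rightarrow> bool" where
  "real_eigenvalue A l \<longleftrightarrow> (\<exists>x. x \<noteq> 0 \<and> A *v x = l *\<^sub>R x)"

definition lambda_min :: "real^'n^'n \<Rightarrow> real" where
  "lambda_min A = (LEAST l. real_eigenvalue A l)"

definition spectral_norm :: "real^'n^'m \<Rightarrow> real" where
  "spectral_norm A = onorm ((*v) A)"

section \<open>The problem and its augmented Lagrangian\<close>

definition objective ::
  "((real^'n) \<times> (real^'d) \<Rightarrow> real) \<Rightarrow> (real^'n \<Rightarrow> ereal) \<Rightarrow> (real^'d \<Rightarrow> real)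
   \<Rightarrow> (real^'n) \<times> (real^'d) \<Rightarrow> ereal" where
  "objective G J H = (\<lambda>(u, v). ereal (G (u, v)) + J u + ereal (H v))"

definition aug_lagrangian ::
  "((real^'n) \<times> (real^'d) \<Rightarrow> real) \<Rightarrow> (real^'n \<Rightarrow> ereal) \<Rightarrow> (real^'d \<Rightarrow> real)
   \<Rightarrow> (real^'n \<Rightarrow> real^'m) \<Rightarrow> real^'d^'m \<Rightarrow> real
   \<Rightarrow> (real^'n) \<times> (real^'d) \<times> (real^'m) \<Rightarrow> ereal" where
  "aug_lagrangian G J H \<Theta> B \<gamma> = (\<lambda>(u, v, p).
     objective G J H (u, v)
       + ereal (p \<bullet> (\<Theta> u + B *v v) + \<gamma> / 2 * (norm (\<Theta> u + B *v v))\<^sup>2))"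

definition subdiff_aug_lagrangian ::
  "(real^'n) set \<Rightarrow> ((real^'n) \<times> (real^'d) \<Rightarrow> real) \<Rightarrow> (real^'n \<Rightarrow> ereal) \<Rightarrow> (real^'d \<Rightarrow> real)
   \<Rightarrow> (real^'n \<Rightarrow> real^'m) \<Rightarrow> real^'d^'m \<Rightarrow> real
   \<Rightarrow> (real^'n) \<times> (real^'d) \<times> (real^'m) \<Rightarrow> ((real^'n) \<times> (real^'d) \<times> (real^'m)) set" where
  "subdiff_aug_lagrangian U G J H \<Theta> B \<gamma> = (\<lambda>(u, v, p).
     {grad_fst G u v + \<xi> + \<eta>
        + transpose (jacobian \<Theta> (at u)) *v (p + \<gamma> *\<^sub>R (\<Theta> u + B *v v))
      | \<xi> \<eta>. \<xi> \<in> limiting_subdifferential J u \<and> \<eta> \<in> normal_cone U u}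
     \<times> {grad_snd G u v + grad H v + transpose B *v (p + \<gamma> *\<^sub>R (\<Theta> u + B *v v))}
     \<times> {\<Theta> u + B *v v})"

definition stationary_point ::
  "(real^'n) set \<Rightarrow> ((real^'n) \<times> (real^'d) \<Rightarrow> real) \<Rightarrow> (real^'n \<Rightarrow> ereal) \<Rightarrow> (real^'d \<Rightarrow> real)
   \<Rightarrow> (real^'n \<Rightarrow> real^'m) \<Rightarrow> real^'d^'m \<Rightarrow> real
   \<Rightarrow> (real^'n) \<times> (real^'d) \<times> (real^'m) \<Rightarrow> bool" where
  "stationary_point U G J H \<Theta> B \<gamma> w \<longleftrightarrow>
     fst w \<in> U \<and> 0 \<in> subdiff_aug_lagrangian U G J H \<Theta> B \<gamma> w"

definition cluster_point :: "(nat \<Rightarrow> 'a::topological_space) \<Rightarrow> 'a \<Rightarrow> bool" where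
  "cluster_point X x \<longleftrightarrow> (\<exists>r. strict_mono r \<and> (X \<circ> r) \<longlonglongrightarrow> x)"

section \<open>The algorithm NAPP-AL\<close>

text \<open>In the two subproblem objectives, \<open>(uk, vk)\<close> is the current iterate, \<open>qk\<close> the current
  shifted multiplier and \<open>\<epsilon>k\<close> the current step size.\<close>

definition u_subproblem ::
  "((real^'n) \<times> (real^'d) \<Rightarrow> real) \<Rightarrow> (real^'n \<Rightarrow> ereal) \<Rightarrow> (real^'n \<Rightarrow> real^'m)
   \<Rightarrow> (real^'n \<Rightarrow> real^'m) \<Rightarrow> (real^'n \<Rightarrow> real)
   \<Rightarrow> real^'n \<Rightarrow> real^'d \<Rightarrow> real^'m \<Rightarrow> real \<Rightarrow> real^'n \<Rightarrow> ereal" where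
  "u_subproblem G J \<Omega> \<Phi> K uk vk qk \<epsilon>k x =
     ereal (grad_fst G uk vk \<bullet> x) + J x
       + ereal (qk \<bullet> (jacobian \<Omega> (at uk) *v x + \<Phi> x) + 1 / \<epsilon>k * bregman K x uk)"

definition v_subproblem ::
  "((real^'n) \<times> (real^'d) \<Rightarrow> real) \<Rightarrow> (real^'d \<Rightarrow> real) \<Rightarrow> real^'d^'m \<Rightarrow> real
   \<Rightarrow> real^'n \<Rightarrow> real^'d \<Rightarrow> real^'m \<Rightarrow> real^'d \<Rightarrow> real" where
  "v_subproblem G H B \<gamma> uk vk qk y =
     (grad_snd G uk vk + grad H vk) \<bullet> y + qk \<bullet> (B *v y)
       + \<gamma> / 2 * (norm (B *v (y - vk)))\<^sup>2"

text \<open>A global minimiser of an extended-valued function is required to have a finite value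
  (the usual convention that the argmin set is empty if the infimum is \<open>\<infinity>\<close>); otherwise every
  point of \<open>U\<close> would be admissible when \<open>J\<close> is identically \<open>\<infinity>\<close> on \<open>U\<close>.\<close>

definition napp_al ::
  "(real^'n) set \<Rightarrow> ((real^'n) \<times> (real^'d) \<Rightarrow> real) \<Rightarrow> (real^'n \<Rightarrow> ereal) \<Rightarrow> (real^'d \<Rightarrow> real)
   \<Rightarrow> (real^'n \<Rightarrow> real^'m) \<Rightarrow> (real^'n \<Rightarrow> real^'m) \<Rightarrow> real^'d^'m \<Rightarrow> (real^'n \<Rightarrow> real)
   \<Rightarrow> real \<Rightarrow> real \<Rightarrow> (nat \<Rightarrow> real) \<Rightarrow> (nat \<Rightarrow> real)
   \<Rightarrow> (nat \<Rightarrow> real^'n) \<Rightarrow> (nat \<Rightarrow> real^'d) \<Rightarrow> (nat \<Rightarrow> real^'m) \<Rightarrow> (nat \<Rightarrow> real^'m) \<Rightarrow> bool" where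
  "napp_al U G J H \<Omega> \<Phi> B K \<gamma> \<sigma> \<delta> \<epsilon> u v p q \<longleftrightarrow>
     (\<forall>k. q k = p k + \<gamma> *\<^sub>R (\<Omega> (u k) + \<Phi> (u k) + B *v v k)
        \<and> \<delta> k > 0 \<and> \<sigma> * \<delta> k \<le> \<epsilon> k \<and> \<epsilon> k \<le> \<delta> k
        \<and> is_arg_min (u_subproblem G J \<Omega> \<Phi> K (u k) (v k) (q k) (\<epsilon> k)) (\<lambda>x. x \<in> U) (u (Suc k))
        \<and> u_subproblem G J \<Omega> \<Phi> K (u k) (v k) (q k) (\<epsilon> k) (u (Suc k)) < \<infinity>
        \<and> is_arg_min (v_subproblem G H B \<gamma> (u k) (v k) (q k)) (\<lambda>_. True) (v (Suc k))
        \<and> p (Suc k) = p k + \<gamma> *\<^sub>R (\<Omega> (u (Suc k)) + \<Phi> (u (Suc k)) + B *v v (Suc k)))"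

end

theory Submission
  imports Defs
begin

text \<open>
  With the identity \<open>B\<^sup>T p\<^sup>k\<^sup>+\<^sup>1 = - \<nabla>\<^sub>v G(u\<^sup>k, v\<^sup>k) - \<nabla> H(v\<^sup>k) + \<gamma> B\<^sup>T (\<Theta>(u\<^sup>k\<^sup>+\<^sup>1) - \<Theta>(u\<^sup>k))\<close>
  and \<open>p\<^sup>k\<^sup>+\<^sup>1 - p\<^sup>k \<in> Im B\<close>, multiplier steps are controlled by primal steps, so that the augmented
  Lagrangian plus multiples of the squared last primal steps decreases strictly. Replacing \<open>v\<^sup>k\<close> by
  the feasible \<open>y\<close> with \<open>\<Theta>(u\<^sup>k) + B y = 0\<close> bounds this Lyapunov function below by the objective
  at \<open>(u\<^sup>k, y)\<close>, and coercivity gives bounded iterates. Since \<open>\<Phi>\<close> need not be continuously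
  differentiable, cluster points are not treated by closedness of the subdifferential: one passes to
  the limit in the minimality of the \<open>u\<close>-subproblem and applies the first-order condition to the
  limit problem.
\<close>

section \<open>Gradients and matrices\<close>

text \<open>The multiplier identity evaluates the gradients at the previous iterate, so a multiplier
  step is bounded by the previous primal steps together with the current \<open>u\<close>-step. The
  extra terms of the Lyapunov function carry these earlier steps from one iteration to the next. The
  condition on \<gamma> enters as \<open>4 * s \<le> \<gamma> * lmin\<close>: the curvature of the
  penalty in \<open>v\<close> must outweigh the possible concavity of \<open>G\<close> and
  \<open>H\<close>. The two factors 14 in \<delta> become 7 after halving and pay for the
  \<open>u\<close>-steps. The start may lie outside \<open>U\<close> or outside the domain of
  \<open>J\<close>, so all statements about function values begin at index one. With a constraint, a
  subgradient of \<open>J\<close> and a normal vector to \<open>U\<close> must be separated from one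
  minimality statement; a penalty does this, and the local Lipschitz constant of \<open>J\<close>
  keeps the normal parts bounded. The step sizes need not converge. In the limit an upper bound
  \<open>T\<close> of all \<open>1 / \<epsilon> k\<close> takes their place, which is harmless
  because the Bregman distance and its gradient vanish at the limit point.\<close>

lemma gderiv_grad:
  fixes f :: "'a::euclidean_space \<Rightarrow> real"
  assumes "f differentiable (at x)"
  shows "GDERIV f x :> grad f x"
proof -
  obtain f' where f': "(f has_derivative f') (at x)"
    using assms by (auto simp: differentiable_def)
  interpret bounded_linear f' using f' by (rule has_derivative_bounded_linear)
  \<comment> \<open>The Riesz representative of the derivative, in coordinates. Its existence here
    and its uniqueness below discharge the definite description in \<open>grad\<close>.\<close>
  define D where "D = (\<Sum>b\<in>Basis. f' b *\<^sub>R b)"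
  have "f' h = h \<bullet> D" for h
  proof -
    have "f' h = f' (\<Sum>b\<in>Basis. (h \<bullet> b) *\<^sub>R b)" by (simp add: euclidean_representation)
    also have "\<dots> = h \<bullet> D" by (simp add: sum scaleR D_def inner_sum_right mult.commute)
    finally show ?thesis .
  qed
  then have D: "GDERIV f x :> D"
    using f' unfolding gderiv_def by (subst ext[of _ f']) auto
  have "D' = D" if "GDERIV f x :> D'" for D'
  proof -
    have "(\<lambda>h. h \<bullet> D') = (\<lambda>h. h \<bullet> D)"
      using D that unfolding gderiv_def by (rule has_derivative_unique[symmetric])
    then have "\<forall>h. h \<bullet> D' = h \<bullet> D" by (auto dest: fun_cong)
    then show ?thesis by (simp only: vector_eq_ldot)
  qed
  with D show ?thesis unfolding grad_def by (rule theI)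
qed

lemma has_derivative_grad:
  fixes f :: "'a::euclidean_space \<Rightarrow> real"
  assumes "f differentiable (at x)"
  shows "(f has_derivative (\<lambda>h. grad f x \<bullet> h)) (at x)"
  using gderiv_grad[OF assms] by (simp add: gderiv_def inner_commute)

lemma grad_eqI:
  fixes f :: "'a::euclidean_space \<Rightarrow> real"
  assumes "(f has_derivative (\<lambda>h. D \<bullet> h)) (at x)"
  shows "grad f x = D"
proof -
  have "f differentiable (at x)" using assms by (auto simp: differentiable_def)
  from has_derivative_unique[OF has_derivative_grad[OF this] assms]
  have "(\<lambda>h. grad f x \<bullet> h) = (\<lambda>h. D \<bullet> h)" .
  then have "\<forall>h. grad f x \<bullet> h = D \<bullet> h" by (auto dest: fun_cong)
  then show ?thesis by (simp only: vector_eq_rdot)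
qed

lemma grad_Pair:
  fixes G :: "'a::euclidean_space \<times> 'b::euclidean_space \<Rightarrow> real"
  assumes "G differentiable (at (x, y))"
  shows "grad G (x, y) = (grad_fst G x y, grad_snd G x y)"
proof -
  note G = has_derivative_grad[OF assms]
  have "((\<lambda>x'. G (x', y)) has_derivative (\<lambda>h. fst (grad G (x, y)) \<bullet> h)) (at x)"
    using has_derivative_compose[OF has_derivative_Pair[OF has_derivative_ident has_derivative_const] G]
    by (simp add: inner_prod_def)
  then have 1: "grad_fst G x y = fst (grad G (x, y))"
    unfolding grad_fst_def by (rule grad_eqI)
  have "((\<lambda>y'. G (x, y')) has_derivative (\<lambda>h. snd (grad G (x, y)) \<bullet> h)) (at y)"
    using has_derivative_compose[OF has_derivative_Pair[OF has_derivative_const has_derivative_ident] G]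
    by (simp add: inner_prod_def)
  then have 2: "grad_snd G x y = snd (grad G (x, y))"
    unfolding grad_snd_def by (rule grad_eqI)
  show ?thesis by (simp add: 1 2)
qed

section \<open>Quadratic estimates from Lipschitz gradients and strong convexity\<close>

lemma lipschitz_grad_upper_bound:
  fixes f :: "'a::euclidean_space \<Rightarrow> real"
  assumes diff: "\<And>x. f differentiable (at x)" and lip: "L-lipschitz_on UNIV (grad f)"
  shows "f y \<le> f x + grad f x \<bullet> (y - x) + L / 2 * (norm (y - x))\<^sup>2"
proof -
  define d where "d = y - x"
  \<comment> \<open>The claim is \<open>\<phi> 1 \<le> \<phi> 0\<close>. The subtracted quadratic is
    chosen so that its derivative \<open>L * t * (norm d)\<^sup>2\<close> is exactly the growth that
    the Lipschitz bound permits.\<close>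
  define \<phi> where "\<phi> t = f (x + t *\<^sub>R d) - t * (grad f x \<bullet> d) - L / 2 * t\<^sup>2 * (norm d)\<^sup>2" for t
  have der: "(\<phi> has_real_derivative
      (grad f (x + t *\<^sub>R d) \<bullet> d - grad f x \<bullet> d - L * t * (norm d)\<^sup>2)) (at t)" for t
  proof -
    have "((\<lambda>t. x + t *\<^sub>R d) has_derivative (\<lambda>s. s *\<^sub>R d)) (at t)"
      by (auto intro!: derivative_eq_intros)
    from has_derivative_compose[OF this has_derivative_grad[OF diff]]
    have "((\<lambda>t. f (x + t *\<^sub>R d)) has_real_derivative (grad f (x + t *\<^sub>R d) \<bullet> d)) (at t)"
      by (simp add: has_field_derivative_def mult_commute_abs)
    then show ?thesis
      unfolding \<phi>_def by (auto intro!: derivative_eq_intros)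
  qed
  have "\<phi> 1 \<le> \<phi> 0"
  proof (rule DERIV_nonpos_imp_nonincreasing[of 0 1 \<phi>])
    fix t :: real assume t: "0 \<le> t" "t \<le> 1"
    have "(grad f (x + t *\<^sub>R d) - grad f x) \<bullet> d \<le> norm (grad f (x + t *\<^sub>R d) - grad f x) * norm d"
      by (rule norm_cauchy_schwarz)
    also have "\<dots> \<le> (L * norm (t *\<^sub>R d)) * norm d"
      using lipschitz_onD[OF lip, of "x + t *\<^sub>R d" x]
      by (intro mult_right_mono) (auto simp: dist_norm)
    also have "\<dots> = L * t * (norm d)\<^sup>2" using t by (simp add: power2_eq_square)
    finally show "\<exists>y. DERIV \<phi> t :> y \<and> y \<le> 0"
      using der[of t] by (auto simp: inner_diff_left)
  qed simp
  then show ?thesis by (simp add: \<phi>_def d_def)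
qed

text \<open>The lower half is the upper bound for \<open>-f\<close>. Both halves are wanted for the
  components of \<Omega>, which are multiplied by multipliers of unknown sign.\<close>

lemma lipschitz_grad_bounds:
  fixes f :: "'a::euclidean_space \<Rightarrow> real"
  assumes diff: "\<And>x. f differentiable (at x)" and lip: "L-lipschitz_on UNIV (grad f)"
  shows "\<bar>f y - f x - grad f x \<bullet> (y - x)\<bar> \<le> L / 2 * (norm (y - x))\<^sup>2"
proof -
  have grad_minus: "grad (\<lambda>x. - f x) x = - grad f x" for x
    using has_derivative_minus[OF has_derivative_grad[OF diff[of x]]]
    by (intro grad_eqI) (simp add: inner_minus_left)
  have "L-lipschitz_on UNIV (grad (\<lambda>x. - f x))"
    using lipschitz_on_minus[OF lip] by (simp add: grad_minus[abs_def])
  from lipschitz_grad_upper_bound[OF _ this, of y x] lipschitz_grad_upper_bound[OF diff lip, of y x]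
  show ?thesis using diff unfolding abs_le_iff by (simp add: grad_minus)
qed

text \<open>Strong convexity on the segment, divided by \<open>t\<close>, bounds the difference
  quotient at \<open>x'\<close>; letting \<open>t\<close> tend to 0 from the right produces the
  gradient term.\<close>

lemma bregman_lower_bound:
  fixes K :: "'a::euclidean_space \<Rightarrow> real"
  assumes diff: "K differentiable (at x')" and sc: "strongly_convex \<beta> K"
  shows "\<beta> / 2 * (norm (x - x'))\<^sup>2 \<le> bregman K x x'"
proof -
  define d where "d = x - x'"
  have "((\<lambda>t. x' + t *\<^sub>R d) has_derivative (\<lambda>s. s *\<^sub>R d)) (at 0)"
    by (auto intro!: derivative_eq_intros)
  from has_derivative_compose[OF this, of K "\<lambda>h. grad K x' \<bullet> h"] has_derivative_grad[OF diff]
  have "((\<lambda>t. K (x' + t *\<^sub>R d)) has_real_derivative (grad K x' \<bullet> d)) (at 0)"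
    by (simp add: has_field_derivative_def mult_commute_abs)
  then have "((\<lambda>t. (K (x' + t *\<^sub>R d) - K x') / t) \<longlongrightarrow> grad K x' \<bullet> d) (at_right 0)"
    by (simp add: has_field_derivative_iff filterlim_at_split)
  moreover have "((\<lambda>t. K x - K x' - \<beta> / 2 * (1 - t) * (norm d)\<^sup>2)
      \<longlongrightarrow> K x - K x' - \<beta> / 2 * (1 - 0) * (norm d)\<^sup>2) (at_right 0)"
    by (intro tendsto_intros)
  moreover have "\<forall>\<^sub>F t in at_right 0. (K (x' + t *\<^sub>R d) - K x') / t
      \<le> K x - K x' - \<beta> / 2 * (1 - t) * (norm d)\<^sup>2"
    unfolding eventually_at_right_field
  proof (intro exI[of _ 1] conjI allI impI)
    fix t :: real assume t: "0 < t" "t < 1"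
    have "K (t *\<^sub>R x + (1 - t) *\<^sub>R x') \<le> t * K x + (1 - t) * K x' - \<beta> / 2 * t * (1 - t) * (norm (x - x'))\<^sup>2"
      using sc t by (auto simp: strongly_convex_def)
    moreover have "t *\<^sub>R x + (1 - t) *\<^sub>R x' = x' + t *\<^sub>R d" by (simp add: d_def algebra_simps)
    ultimately have "K (x' + t *\<^sub>R d) - K x' \<le> (K x - K x' - \<beta> / 2 * (1 - t) * (norm d)\<^sup>2) * t"
      by (simp add: d_def[symmetric] algebra_simps)
    then show "(K (x' + t *\<^sub>R d) - K x') / t \<le> K x - K x' - \<beta> / 2 * (1 - t) * (norm d)\<^sup>2"
      using t by (simp only: pos_divide_le_eq)
  qed simp
  ultimately have "grad K x' \<bullet> d \<le> K x - K x' - \<beta> / 2 * (1 - 0) * (norm d)\<^sup>2"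
    by (intro tendsto_le[OF trivial_limit_at_right_real])
  then show ?thesis by (simp add: bregman_def d_def)
qed

text \<open>For a short step along \<open>h\<close> the linearization error is at most
  \<open>e\<close> times the step, so the derivative inherits the Lipschitz constant up to
  \<open>e\<close>. No continuity of the derivative is involved, as befits \<Theta>.\<close>

lemma has_derivative_lipschitz_bound:
  fixes f :: "'a::real_normed_vector \<Rightarrow> 'b::real_normed_vector"
  assumes lip: "L-lipschitz_on UNIV f" and der: "(f has_derivative f') (at x)"
  shows "norm (f' h) \<le> L * norm h"
proof -
  interpret f': bounded_linear f' using der by (rule has_derivative_bounded_linear)
  show ?thesis
  proof (cases "h = 0")
    case False
    have *: "norm (f' h) \<le> (L + e) * norm h" if e: "e > 0" for e
    proof -
      obtain d where d: "d > 0"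
        "\<And>y. norm (y - x) < d \<Longrightarrow> norm (f y - f x - f' (y - x)) \<le> e * norm (y - x)"
        using der e unfolding has_derivative_at_alt by blast
      define t where "t = d / (2 * norm h)"
      have t: "t > 0" "t * norm h < d" using d False by (auto simp: t_def)
      have "norm (f (x + t *\<^sub>R h) - f x - t *\<^sub>R f' h) \<le> e * (t * norm h)"
        using d(2)[of "x + t *\<^sub>R h"] t by (simp add: f'.scaleR)
      moreover have "norm (f (x + t *\<^sub>R h) - f x) \<le> L * (t * norm h)"
        using lipschitz_onD[OF lip, of "x + t *\<^sub>R h" x] t by (simp add: dist_norm)
      moreover have "norm (t *\<^sub>R f' h)
          \<le> norm (f (x + t *\<^sub>R h) - f x) + norm (f (x + t *\<^sub>R h) - f x - t *\<^sub>R f' h)"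
        using norm_triangle_ineq4[of "f (x + t *\<^sub>R h) - f x" "f (x + t *\<^sub>R h) - f x - t *\<^sub>R f' h"]
        by simp
      ultimately have "t * norm (f' h) \<le> t * ((L + e) * norm h)"
        using t by (simp add: algebra_simps)
      then show ?thesis using t by simp
    qed
    show ?thesis
    proof (rule field_le_epsilon)
      fix e :: real assume "e > 0"
      then show "norm (f' h) \<le> L * norm h + e"
        using *[of "e / norm h"] False by (simp add: distrib_right)
    qed
  qed simp
qed

section \<open>Transposes, spectral norm and the smallest eigenvalue of the Gram matrix\<close>

lemma inner_transpose_mult:
  fixes A :: "real^'n^'m"
  shows "(transpose A *v y) \<bullet> x = y \<bullet> (A *v x)"
  by (simp add: dot_lmul_matrix flip: vector_transpose_matrix)

lemma transpose_add_mult: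
  fixes A A' :: "real^'n^'m"
  shows "transpose (A + A') *v y = transpose A *v y + transpose A' *v y"
proof -
  have "\<forall>x. (transpose (A + A') *v y) \<bullet> x = (transpose A *v y + transpose A' *v y) \<bullet> x"
    unfolding inner_add_left inner_transpose_mult
    by (simp add: matrix_vector_mult_add_rdistrib inner_add_right)
  then show ?thesis by (simp only: vector_eq_rdot)
qed

lemma transpose_diff_mult:
  fixes A A' :: "real^'n^'m"
  shows "transpose (A - A') *v y = transpose A *v y - transpose A' *v y"
  using transpose_add_mult[of "A - A'" A' y] by (simp del: transpose_matrix_vector)

lemma norm_transpose_mult_le:
  fixes A :: "real^'n^'m"
  assumes "\<And>x. norm (A *v x) \<le> C * norm x"
  shows "norm (transpose A *v y) \<le> C * norm y"
proof (cases "transpose A *v y = 0")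
  case True
  \<comment> \<open>When the left side vanishes, the claim still needs \<open>C \<ge> 0\<close>; the
    hypothesis at a unit vector provides it.\<close>
  have "0 \<le> C * norm (axis undefined 1 :: real^'n)" using assms norm_ge_zero order_trans by blast
  then have "0 \<le> C" by (simp add: norm_axis_1)
  with True show ?thesis by simp
next
  case False
  let ?z = "transpose A *v y"
  have "(norm ?z)\<^sup>2 = y \<bullet> (A *v ?z)" by (simp add: power2_norm_eq_inner dot_lmul_matrix)
  also have "\<dots> \<le> norm y * (C * norm ?z)"
    using norm_cauchy_schwarz[of y "A *v ?z"] assms[of ?z]
    by (meson mult_left_mono norm_ge_zero order_trans)
  finally show ?thesis using False by (simp add: power2_eq_square mult.commute mult.left_commute)
qed

lemma norm_mult_le_spectral_norm:
  fixes A :: "real^'n^'m"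
  shows "norm (A *v x) \<le> spectral_norm A * norm x"
  unfolding spectral_norm_def by (intro onorm matrix_vector_mul_bounded_linear)

lemma spectral_norm_nonneg: "0 \<le> spectral_norm A"
  unfolding spectral_norm_def by (intro onorm_pos_le matrix_vector_mul_bounded_linear)

text \<open>The minimum \<open>l\<close> of the Rayleigh quotient is attained on the compact sphere
  and is positive by injectivity. Perturbing the minimizer \<open>z\<close> by its eigenvector
  defect \<open>y\<close> gives a nonnegative quadratic in \<open>t\<close> with linear coefficient
  \<open>2 * (y \<bullet> y)\<close>, which forces \<open>y = 0\<close>. So \<open>l\<close> is an
  eigenvalue, and every eigenvalue is a value of the quotient.\<close>

lemma lambda_min_gram:
  fixes B :: "real^'d^'m"
  assumes "inj ((*v) B)"
  shows "0 < lambda_min (transpose B ** B)"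
    and "lambda_min (transpose B ** B) * (norm x)\<^sup>2 \<le> (norm (B *v x))\<^sup>2"
proof -
  let ?A = "transpose B ** B"
  have gram: "(?A *v x) \<bullet> y = (B *v x) \<bullet> (B *v y)" for x y
    by (simp add: dot_lmul_matrix flip: matrix_vector_mul_assoc)
  have "compact (sphere (0::real^'d) 1)" "sphere (0::real^'d) 1 \<noteq> {}" by auto
  moreover have "continuous_on (sphere 0 1) (\<lambda>x. (norm (B *v x))\<^sup>2)"
    by (intro continuous_intros matrix_vector_mult_linear_continuous_on)
  ultimately obtain z where z: "norm z = 1" and zmin: "\<And>y. norm y = 1 \<Longrightarrow> (norm (B *v z))\<^sup>2 \<le> (norm (B *v y))\<^sup>2"
    using continuous_attains_inf[of "sphere (0::real^'d) 1" "\<lambda>x. (norm (B *v x))\<^sup>2"] by auto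
  define l where "l = (norm (B *v z))\<^sup>2"
  have "z \<noteq> 0" using z by auto
  then have "B *v z \<noteq> 0" using assms by (metis injD matrix_vector_mult_0_right)
  then have lpos: "0 < l" by (simp add: l_def)
  have bound: "l * (norm y)\<^sup>2 \<le> (norm (B *v y))\<^sup>2" for y
  proof (cases "y = 0")
    case False
    then have "l \<le> (norm (B *v (y /\<^sub>R norm y)))\<^sup>2" unfolding l_def by (intro zmin) auto
    also have "\<dots> = (norm (B *v y))\<^sup>2 / (norm y)\<^sup>2"
      by (simp add: matrix_vector_mult_scaleR power_mult_distrib power_inverse field_simps)
    finally show ?thesis using False by (simp add: field_simps)
  qed simp
  have "real_eigenvalue ?A l"
    unfolding real_eigenvalue_def
  proof (intro exI[of _ z] conjI)
    define y where "y = ?A *v z - l *\<^sub>R z"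
    have q: "0 \<le> 2 * t * (y \<bullet> y) + t\<^sup>2 * ((norm (B *v y))\<^sup>2 - l * (norm y)\<^sup>2)" for t
    proof -
      have "l * (norm (z + t *\<^sub>R y))\<^sup>2 \<le> (norm (B *v (z + t *\<^sub>R y)))\<^sup>2" by (rule bound)
      also have "(norm (B *v (z + t *\<^sub>R y)))\<^sup>2
          = l + 2 * t * ((B *v z) \<bullet> (B *v y)) + t\<^sup>2 * (norm (B *v y))\<^sup>2"
        unfolding l_def power2_norm_eq_inner
        by (simp add: matrix_vector_right_distrib matrix_vector_mult_scaleR inner_simps
            inner_commute power2_eq_square algebra_simps)
      also have "(B *v z) \<bullet> (B *v y) = y \<bullet> y + l * (z \<bullet> y)"
      proof -
        have "?A *v z = y + l *\<^sub>R z" by (simp add: y_def)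
        then show ?thesis by (simp add: gram[symmetric] inner_simps)
      qed
      finally have "l * (norm (z + t *\<^sub>R y))\<^sup>2
          \<le> l + 2 * t * (y \<bullet> y + l * (z \<bullet> y)) + t\<^sup>2 * (norm (B *v y))\<^sup>2" .
      moreover have "(norm (z + t *\<^sub>R y))\<^sup>2 = 1 + 2 * t * (z \<bullet> y) + t\<^sup>2 * (norm y)\<^sup>2"
        using z[THEN arg_cong, of "\<lambda>r. r\<^sup>2"] unfolding power2_norm_eq_inner
        by (simp add: inner_simps inner_commute power2_eq_square algebra_simps)
      ultimately show ?thesis by (simp add: algebra_simps)
    qed
    define c where "c = (norm (B *v y))\<^sup>2 - l * (norm y)\<^sup>2"
    have c: "0 \<le> c" using bound[of y] by (simp add: c_def)
    have "y \<bullet> y \<le> 0"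
    proof (rule ccontr)
      assume *: "\<not> y \<bullet> y \<le> 0"
      \<comment> \<open>At \<open>-t\<close> the quadratic equals
        \<open>t\<^sup>2 * (- c - 2)\<close>, which is negative; the added 1 covers the case
        \<open>c = 0\<close>.\<close>
      define t where "t = y \<bullet> y / (c + 1)"
      have t: "t > 0" using * c unfolding t_def by (intro divide_pos_pos) linarith+
      have yy: "y \<bullet> y = t * (c + 1)" using c by (simp add: t_def)
      have "0 \<le> 2 * (- t) * (y \<bullet> y) + (- t)\<^sup>2 * c"
        using q[of "- t"] by (simp add: c_def)
      also have "\<dots> = t\<^sup>2 * (- c - 2)"
        by (simp add: yy power2_eq_square algebra_simps)
      also have "\<dots> < 0" using c t by (intro mult_pos_neg) auto
      finally show False by simp
    qed
    then have "y = 0" by (metis inner_gt_zero_iff not_le)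
    then show "?A *v z = l *\<^sub>R z" by (simp add: y_def)
  qed fact
  moreover have "l \<le> l'" if l': "real_eigenvalue ?A l'" for l'
  proof -
    obtain y where y: "y \<noteq> 0" "?A *v y = l' *\<^sub>R y" using l' by (auto simp: real_eigenvalue_def)
    have "l * (norm y)\<^sup>2 \<le> (B *v y) \<bullet> (B *v y)" using bound[of y] by (simp add: power2_norm_eq_inner)
    also have "\<dots> = l' * (norm y)\<^sup>2" by (simp add: gram[symmetric] y power2_norm_eq_inner)
    finally show ?thesis using y by simp
  qed
  ultimately have "lambda_min ?A = l"
    unfolding lambda_min_def by (rule Least_equality)
  with lpos bound show "0 < lambda_min ?A" "lambda_min ?A * (norm x)\<^sup>2 \<le> (norm (B *v x))\<^sup>2" by auto
qed

text \<open>The transpose is bounded below only on the range of \<open>B\<close>: for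
  \<open>r = B *v x\<close> one has
  \<open>(norm r)\<^sup>2 = (transpose B *v r) \<bullet> x\<close>, and \<open>norm x\<close> is
  controlled by \<open>norm r\<close> through the Gram matrix. This recovers multiplier steps from
  their images under \<open>transpose B\<close>.\<close>

lemma norm_transpose_mult_ge:
  fixes B :: "real^'d^'m"
  assumes "inj ((*v) B)" and r: "r \<in> range ((*v) B)"
  shows "lambda_min (transpose B ** B) * (norm r)\<^sup>2 \<le> (norm (transpose B *v r))\<^sup>2"
proof -
  let ?l = "lambda_min (transpose B ** B)"
  note l = lambda_min_gram[OF assms(1)]
  obtain x where x: "r = B *v x" using r by auto
  show ?thesis
  proof (cases "r = 0")
    case False
    have "(norm r)\<^sup>2 = (transpose B *v r) \<bullet> x"
      by (simp add: dot_lmul_matrix power2_norm_eq_inner x)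
    also have "\<dots> \<le> norm (transpose B *v r) * norm x" by (rule norm_cauchy_schwarz)
    finally have "((norm r)\<^sup>2)\<^sup>2 \<le> (norm (transpose B *v r) * norm x)\<^sup>2" by (intro power_mono) auto
    then have "?l * ((norm r)\<^sup>2)\<^sup>2 \<le> (norm (transpose B *v r))\<^sup>2 * (?l * (norm x)\<^sup>2)"
      using l(1) by (simp add: power_mult_distrib mult.left_commute mult_left_mono)
    also have "\<dots> \<le> (norm (transpose B *v r))\<^sup>2 * (norm r)\<^sup>2"
      using l(2)[of x] by (intro mult_left_mono) (auto simp: x)
    finally show ?thesis using False by (simp add: power2_eq_square)
  qed simp
qed

section \<open>Jacobians whose component gradients are Lipschitz\<close>

lemma jacobian_component:
  fixes f :: "real^'n \<Rightarrow> real^'m"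
  assumes "f differentiable (at x)"
  shows "(jacobian f (at x) *v h) $ j = grad (\<lambda>x. f x $ j) x \<bullet> h"
proof -
  have "(f has_derivative (\<lambda>h. jacobian f (at x) *v h)) (at x)"
    using assms by (simp add: jacobian_works)
  then have "((\<lambda>x. f x $ j) has_derivative (\<lambda>h. (jacobian f (at x) *v h) $ j)) (at x)"
    by (rule bounded_linear.has_derivative[OF bounded_linear_vec_nth])
  moreover have "(\<lambda>x. f x $ j) differentiable (at x)" using calculation by (auto simp: differentiable_def)
  ultimately show ?thesis
    using has_derivative_unique has_derivative_grad by (metis (no_types, lifting))
qed

lemma jacobian_add:
  fixes f g :: "real^'n \<Rightarrow> real^'m"
  assumes "f differentiable (at x)" "g differentiable (at x)"
  shows "jacobian (\<lambda>x. f x + g x) (at x) = jacobian f (at x) + jacobian g (at x)"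
proof -
  have "((\<lambda>x. f x + g x) has_derivative (\<lambda>h. jacobian f (at x) *v h + jacobian g (at x) *v h)) (at x)"
    using assms by (intro has_derivative_add) (simp_all add: jacobian_works)
  moreover have "((\<lambda>x. f x + g x) has_derivative (\<lambda>h. jacobian (\<lambda>x. f x + g x) (at x) *v h)) (at x)"
    using assms by (simp add: jacobian_works[symmetric])
  ultimately have "(\<lambda>h. jacobian (\<lambda>x. f x + g x) (at x) *v h)
      = (\<lambda>h. jacobian f (at x) *v h + jacobian g (at x) *v h)"
    by (rule has_derivative_unique[symmetric])
  then show ?thesis
    by (simp add: matrix_eq matrix_vector_mult_add_rdistrib fun_eq_iff)
qed

text \<open>The Euclidean norm is estimated by the sum of the absolute components, which is why the
  constant of \<Omega> is the sum of the component constants.\<close>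

lemma jacobian_taylor_bound:
  fixes f :: "real^'n \<Rightarrow> real^'m"
  assumes diff: "\<And>x. f differentiable (at x)"
    and lip: "\<And>j. (L j)-lipschitz_on UNIV (grad (\<lambda>x. f x $ j))"
  shows "norm (f y - f x - jacobian f (at x) *v (y - x)) \<le> (\<Sum>j\<in>UNIV. L j) / 2 * (norm (y - x))\<^sup>2"
proof -
  have "(\<lambda>x. f x $ j) differentiable (at x)" for j x
    using bounded_linear.has_derivative[OF bounded_linear_vec_nth] diff
    unfolding differentiable_def by blast
  from lipschitz_grad_bounds[OF this lip]
  have "\<bar>(f y - f x - jacobian f (at x) *v (y - x)) $ j\<bar> \<le> L j / 2 * (norm (y - x))\<^sup>2" for j
    by (simp add: jacobian_component[OF diff])
  then have "(\<Sum>j\<in>UNIV. \<bar>(f y - f x - jacobian f (at x) *v (y - x)) $ j\<bar>)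
      \<le> (\<Sum>j\<in>UNIV. L j / 2 * (norm (y - x))\<^sup>2)" by (rule sum_mono)
  with norm_le_l1_cart[of "f y - f x - jacobian f (at x) *v (y - x)"]
  show ?thesis by (simp add: sum_distrib_right sum_divide_distrib)
qed

lemma jacobian_lipschitz:
  fixes f :: "real^'n \<Rightarrow> real^'m"
  assumes diff: "\<And>x. f differentiable (at x)"
    and lip: "\<And>j. (L j)-lipschitz_on UNIV (grad (\<lambda>x. f x $ j))"
  shows "norm ((jacobian f (at y) - jacobian f (at x)) *v h) \<le> (\<Sum>j\<in>UNIV. L j) * norm (y - x) * norm h"
proof -
  let ?d = "(jacobian f (at y) - jacobian f (at x)) *v h"
  have "\<bar>?d $ j\<bar> \<le> L j * norm (y - x) * norm h" for j
  proof -
    have "?d $ j = (grad (\<lambda>x. f x $ j) y - grad (\<lambda>x. f x $ j) x) \<bullet> h"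
      by (simp add: matrix_vector_mult_diff_rdistrib jacobian_component[OF diff] inner_diff_left)
    also have "\<bar>\<dots>\<bar> \<le> norm (grad (\<lambda>x. f x $ j) y - grad (\<lambda>x. f x $ j) x) * norm h"
      by (rule Cauchy_Schwarz_ineq2)
    also have "\<dots> \<le> L j * norm (y - x) * norm h"
      using lipschitz_onD[OF lip[of j], of y x] by (intro mult_right_mono) (auto simp: dist_norm)
    finally show ?thesis .
  qed
  then have "(\<Sum>j\<in>UNIV. \<bar>?d $ j\<bar>) \<le> (\<Sum>j\<in>UNIV. L j * norm (y - x) * norm h)" by (rule sum_mono)
  with norm_le_l1_cart[of ?d] show ?thesis by (simp add: sum_distrib_right)
qed

section \<open>First-order conditions with the limiting subdifferential\<close>

text \<open>A division-free criterion. A value \<open>\<infinity>\<close> of \<open>J y\<close>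
  satisfies the inequality trivially, and \<open>-\<infinity>\<close> contradicts it because
  \<open>J x\<close> is finite.\<close>

lemma mem_frechet_subdifferentialI:
  fixes J :: "'a::real_inner \<Rightarrow> ereal"
  assumes fin: "\<bar>J x\<bar> \<noteq> \<infinity>"
    and J: "\<And>e. e > 0 \<Longrightarrow> \<forall>\<^sub>F y in at x. J x + ereal (\<xi> \<bullet> (y - x) - e * norm (y - x)) \<le> J y"
  shows "\<xi> \<in> frechet_subdifferential J x"
proof -
  obtain r where r: "J x = ereal r" using fin by auto
  have "0 \<le> Liminf (at x) (\<lambda>y. (J y - J x - ereal (\<xi> \<bullet> (y - x))) / ereal (norm (y - x)))"
    unfolding le_Liminf_iff
  proof (intro allI impI)
    fix c :: ereal assume "c < 0"
    then obtain e where e: "c < ereal (- e)" "0 < e"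
      using ereal_dense2[of c 0] by (metis ereal_less(2) less_ereal.simps(1) minus_minus neg_less_0_iff_less zero_ereal_def)
    have "\<forall>\<^sub>F y in at x. J x + ereal (\<xi> \<bullet> (y - x) - e * norm (y - x)) \<le> J y" using J e by auto
    moreover have "\<forall>\<^sub>F y in at x. y \<noteq> x" by (simp add: eventually_at_filter)
    ultimately show "\<forall>\<^sub>F y in at x. c < (J y - J x - ereal (\<xi> \<bullet> (y - x))) / ereal (norm (y - x))"
    proof eventually_elim
      case (elim y)
      then have pos: "norm (y - x) > 0" by simp
      have "ereal (- e) \<le> (J y - J x - ereal (\<xi> \<bullet> (y - x))) / ereal (norm (y - x))"
      proof (cases "J y")
        case (real s)
        then have "r + (\<xi> \<bullet> (y - x) - e * norm (y - x)) \<le> s" using elim r by simp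
        then have "- e \<le> (s - r - \<xi> \<bullet> (y - x)) / norm (y - x)"
          using pos by (simp add: pos_le_divide_eq)
        then show ?thesis using pos real r by simp
      qed (use elim r pos in \<open>auto simp: ereal_divide_eq\<close>)
      with e show ?case by (rule_tac less_le_trans)
    qed
  qed
  then show ?thesis using fin by (simp add: frechet_subdifferential_def)
qed

lemma frechet_subset_limiting: "frechet_subdifferential J x \<subseteq> limiting_subdifferential J x"
proof
  fix \<xi> assume \<xi>: "\<xi> \<in> frechet_subdifferential J x"
  then have "\<bar>J x\<bar> \<noteq> \<infinity>" by (simp add: frechet_subdifferential_def)
  then show "\<xi> \<in> limiting_subdifferential J x"
    unfolding limiting_subdifferential_def using \<xi>
    by (intro CollectI conjI exI[of _ "\<lambda>_. x"] exI[of _ "\<lambda>_. \<xi>"]) auto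
qed

text \<open>
  The arguments of \<open>J\<close> and of the constraint are decoupled into \<open>x\<close> and \<open>y\<close> by the penalty
  \<open>N \<parallel>x - y\<parallel>\<^sup>2\<close>. The slack \<open>e\<close> is doubled and charged to \<open>y\<close>, so that it forces \<open>y\<close> towards
  \<open>x0\<close> and disturbs only the convex part.
\<close>

lemma penalized_stationarity:
  fixes J :: "'a::euclidean_space \<Rightarrow> real"
  assumes U: "closed U" "convex U" "x0 \<in> U"
    and r: "r > 0" and lip: "L-lipschitz_on (cball x0 r) J"
    and e: "e > 0"
    and opt: "\<And>x. x \<in> U \<Longrightarrow> x \<in> cball x0 r \<Longrightarrow> J x0 \<le> J x + g \<bullet> (x - x0) + e * norm (x - x0)"
  obtains x y \<eta> where "dist x x0 < r" "dist x x0 \<le> e" "y \<in> U" "dist y x0 \<le> e"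
    "\<And>s. s > 0 \<Longrightarrow> \<forall>\<^sub>F z in at x. J x + ((- g - \<eta>) \<bullet> (z - x) - s * norm (z - x)) \<le> J z"
    "\<And>\<zeta>. \<zeta> \<in> U \<Longrightarrow> \<eta> \<bullet> (\<zeta> - y) \<le> 2 * e * norm (\<zeta> - y)"
    "norm \<eta> \<le> 2 * (L + norm g)"
proof -
  have L: "0 \<le> L" using lip by (rule lipschitz_on_nonneg)
  define M where "M = L + norm g + 1"
  have M: "M \<ge> 1" using L by (simp add: M_def)
  \<comment> \<open>\<open>y\<close> will lie within \<open>t\<close> and \<open>x\<close> within
    \<open>2 * t\<close> of \<open>x0\<close>; this places both within \<open>e\<close>, and
    strictly inside the ball of radius \<open>r\<close>, where two-sided variations are
    possible.\<close>
  define t where "t = min (r / 2) e / 2"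
  have t: "t > 0" "2 * t \<le> r / 2" "2 * t \<le> e" using r e by (auto simp: t_def)
  \<comment> \<open>The first summand brings \<open>x\<close> and \<open>y\<close> together
    (\<open>N1\<close>), the second brings \<open>y\<close> to \<open>x0\<close>
    (\<open>N2\<close>).\<close>
  define N where "N = M / t + M\<^sup>2 / (e * t)"
  have N: "N > 0" using M t e by (auto simp: N_def intro!: add_pos_pos)
  have N1: "M / N \<le> t"
  proof -
    have "M / t \<le> N" using e t M by (simp add: N_def)
    then show ?thesis using N t by (simp add: field_simps)
  qed
  have N2: "M\<^sup>2 / (N * e) \<le> t"
  proof -
    have "M\<^sup>2 / (e * t) \<le> N" using e t M by (simp add: N_def)
    then show ?thesis using N t e by (simp add: field_simps)
  qed
  define P where "P z = J (fst z) + g \<bullet> (fst z - x0) + 2 * e * norm (snd z - x0)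
      + N * (norm (fst z - snd z))\<^sup>2" for z :: "'a \<times> 'a"
  let ?S = "cball x0 r \<times> (U \<inter> cball x0 r)"
  have "compact ?S" using U by (intro compact_Times closed_Int_compact) auto
  moreover have "(x0, x0) \<in> ?S" using U r by auto
  moreover have "continuous_on ?S P"
    unfolding P_def
    by (intro continuous_intros continuous_on_compose2[OF lipschitz_on_continuous_on[OF lip]]) auto
  ultimately obtain z where z: "z \<in> ?S" and zmin: "\<And>z'. z' \<in> ?S \<Longrightarrow> P z \<le> P z'"
    using continuous_attains_inf[of ?S P] by blast
  obtain x y where xy: "z = (x, y)" by (cases z)
  have x: "x \<in> cball x0 r" and y: "y \<in> U" "y \<in> cball x0 r" using z xy by auto
  have "P (x, y) \<le> J x0" using zmin[of "(x0, x0)"] U r by (simp add: P_def xy)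
  \<comment> \<open>The hypothesis speaks about points of \<open>U\<close>, so it is applied at
    \<open>y\<close>. It uses up half of the doubled slack; the other half stays on the left of
    \<open>key\<close> and controls \<open>norm (y - x0)\<close>.\<close>
  also have "J x0 \<le> J y + g \<bullet> (y - x0) + e * norm (y - x0)" using opt y by blast
  finally have "e * norm (y - x0) + N * (norm (x - y))\<^sup>2 \<le> (J y - J x) + g \<bullet> (y - x)"
    by (simp add: P_def inner_diff_right)
  also have "\<dots> \<le> L * norm (x - y) + norm g * norm (x - y)"
    using lipschitz_onD[OF lip x y(2)] norm_cauchy_schwarz[of g "y - x"]
    by (intro add_mono) (auto simp: dist_norm norm_minus_commute)
  finally have key: "e * norm (y - x0) + N * (norm (x - y))\<^sup>2 \<le> (L + norm g) * norm (x - y)"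
    by (simp add: distrib_right)
  have Nd: "N * norm (x - y) \<le> L + norm g"
  proof (cases "x = y")
    case False
    have "N * norm (x - y) * norm (x - y) \<le> (L + norm g) * norm (x - y)"
      using key e by (simp add: power2_eq_square mult.assoc) (smt (verit) mult_nonneg_nonneg norm_ge_zero)
    then show ?thesis using False by simp
  qed (use L in simp)
  then have dxy: "norm (x - y) \<le> M / N"
    using N by (simp add: M_def field_simps)
  have "e * norm (y - x0) \<le> M * norm (x - y)"
  proof -
    have "e * norm (y - x0) \<le> (L + norm g) * norm (x - y)"
      using key N by (smt (verit) mult_nonneg_nonneg zero_le_power2)
    also have "\<dots> \<le> M * norm (x - y)" by (intro mult_right_mono) (auto simp: M_def)
    finally show ?thesis .
  qed
  also have "\<dots> \<le> M * (M / N)" using dxy M by (intro mult_left_mono) auto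
  finally have "norm (y - x0) \<le> M\<^sup>2 / (N * e)"
    using e N by (simp add: field_simps power2_eq_square)
  then have dy: "dist y x0 \<le> t" using N2 by (simp add: dist_norm)
  have "dist x x0 \<le> dist x y + dist y x0" by (rule dist_triangle)
  then have dx: "dist x x0 \<le> 2 * t" using dxy N1 dy by (simp add: dist_norm)
  \<comment> \<open>The gradient of the penalty in its first argument and minus the gradient in its
    second. Hence one vector serves both as part of the subgradient at \<open>x\<close> and as
    approximate normal at \<open>y\<close>.\<close>
  define \<eta> where "\<eta> = (2 * N) *\<^sub>R (x - y)"
  show ?thesis
  proof (rule that[of x y \<eta>])
    show "dist x x0 < r" "dist x x0 \<le> e" "dist y x0 \<le> e" using dx dy t r by auto
    show "y \<in> U" by fact
    show "norm \<eta> \<le> 2 * (L + norm g)" using Nd N by (simp add: \<eta>_def)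
  next
    fix s :: real assume s: "s > 0"
    have "\<forall>\<^sub>F z in nhds x. z \<in> ball x0 r"
      using dx t r by (intro eventually_nhds_in_open) (auto simp: dist_commute)
    moreover have "\<forall>\<^sub>F z in nhds x. dist z x < s / N"
      using eventually_nhds_in_open[of "ball x (s / N)" x] s N by (auto simp: dist_commute elim: eventually_mono)
    ultimately have "\<forall>\<^sub>F z in nhds x. J x + ((- g - \<eta>) \<bullet> (z - x) - s * norm (z - x)) \<le> J z"
    proof eventually_elim
      case (elim z)
      have "P (x, y) \<le> P (z, y)" using zmin[of "(z, y)"] elim y by (auto simp: xy)
      then have 1: "J x + g \<bullet> (x - x0) + N * (norm (x - y))\<^sup>2 \<le> J z + g \<bullet> (z - x0) + N * (norm (z - y))\<^sup>2"
        by (simp add: P_def)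
      have 2: "(norm (z - y))\<^sup>2 = (norm (x - y))\<^sup>2 + 2 * ((x - y) \<bullet> (z - x)) + (norm (z - x))\<^sup>2"
        unfolding power2_norm_eq_inner by (simp add: inner_simps inner_commute)
      have 3: "N * (norm (z - x))\<^sup>2 \<le> s * norm (z - x)"
      proof -
        have "N * norm (z - x) \<le> s" using elim N by (simp add: dist_norm field_simps)
        then show ?thesis by (simp add: power2_eq_square mult_right_mono flip: mult.assoc)
      qed
      have 4: "N * (norm (z - y))\<^sup>2 = N * (norm (x - y))\<^sup>2 + \<eta> \<bullet> (z - x) + N * (norm (z - x))\<^sup>2"
        unfolding 2 by (simp add: \<eta>_def algebra_simps)
      show ?case using 1 3 unfolding 4 by (simp add: inner_simps)
    qed
    then show "\<forall>\<^sub>F z in at x. J x + ((- g - \<eta>) \<bullet> (z - x) - s * norm (z - x)) \<le> J z"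
      by (simp add: eventually_at_filter eventually_mono)
  next
    fix \<zeta> assume \<zeta>: "\<zeta> \<in> U"
    define d where "d = \<zeta> - y"
    \<comment> \<open>Moving \<open>y\<close> by a fraction \<tau> towards \<zeta> stays in
      \<open>U\<close> by convexity. After division by \<tau> the quadratic remainder still carries
      a factor \<tau> and disappears.\<close>
    have "((\<lambda>\<tau>. 2 * e * norm d + N * \<tau> * (norm d)\<^sup>2) \<longlongrightarrow> 2 * e * norm d + N * 0 * (norm d)\<^sup>2) (at_right 0)"
      by (intro tendsto_intros)
    moreover have "\<forall>\<^sub>F \<tau> in at_right 0. \<eta> \<bullet> d \<le> 2 * e * norm d + N * \<tau> * (norm d)\<^sup>2"
    proof -
      have "((\<lambda>\<tau>::real. y + \<tau> *\<^sub>R d) \<longlongrightarrow> y + 0 *\<^sub>R d) (at_right 0)" by (intro tendsto_intros)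
      moreover have "y + 0 *\<^sub>R d \<in> ball x0 r" using dy t r by (auto simp: dist_commute)
      ultimately have "\<forall>\<^sub>F \<tau> in at_right 0. y + \<tau> *\<^sub>R d \<in> ball x0 r"
        by (rule topological_tendstoD[OF _ open_ball])
      moreover have "\<forall>\<^sub>F \<tau>::real in at_right 0. \<tau> \<in> {0<..<1}"
        by (rule eventually_at_right_real) simp
      ultimately show ?thesis
      proof eventually_elim
        case (elim \<tau>)
        have "y + \<tau> *\<^sub>R d = (1 - \<tau>) *\<^sub>R y + \<tau> *\<^sub>R \<zeta>" by (simp add: d_def algebra_simps)
        then have "y + \<tau> *\<^sub>R d \<in> U" using U y \<zeta> elim by (auto simp: convex_alt)
        then have "P (x, y) \<le> P (x, y + \<tau> *\<^sub>R d)" using zmin[of "(x, y + \<tau> *\<^sub>R d)"] elim x by (auto simp: xy)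
        then have 1: "2 * e * norm (y - x0) + N * (norm (x - y))\<^sup>2
            \<le> 2 * e * norm (y + \<tau> *\<^sub>R d - x0) + N * (norm (x - (y + \<tau> *\<^sub>R d)))\<^sup>2"
          by (simp add: P_def)
        have "norm (y + \<tau> *\<^sub>R d - x0) \<le> norm (y - x0) + \<tau> * norm d"
          using norm_triangle_ineq[of "y - x0" "\<tau> *\<^sub>R d"] elim by (simp add: algebra_simps)
        then have 2: "2 * e * norm (y + \<tau> *\<^sub>R d - x0) \<le> 2 * e * (norm (y - x0) + \<tau> * norm d)"
          using e by (intro mult_left_mono) auto
        have 3: "N * (norm (x - (y + \<tau> *\<^sub>R d)))\<^sup>2 = N * (norm (x - y))\<^sup>2 - \<tau> * (\<eta> \<bullet> d) + N * \<tau>\<^sup>2 * (norm d)\<^sup>2"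
          unfolding power2_norm_eq_inner
          by (simp add: \<eta>_def inner_simps inner_commute power2_eq_square algebra_simps)
        have "\<tau> * (\<eta> \<bullet> d) \<le> \<tau> * (2 * e * norm d + N * \<tau> * (norm d)\<^sup>2)"
          using 1 2 unfolding 3 by (simp add: algebra_simps power2_eq_square)
        then show ?case using elim by simp
      qed
    qed
    ultimately have "\<eta> \<bullet> d \<le> 2 * e * norm d + N * 0 * (norm d)\<^sup>2"
      by (rule tendsto_lowerbound) simp
    then show "\<eta> \<bullet> (\<zeta> - y) \<le> 2 * e * norm (\<zeta> - y)" by (simp add: d_def)
  qed
qed

text \<open>\<open>f\<close> is linearized at \<open>x0\<close> once, with slack
  \<open>e * norm (x - x0)\<close>, so the same vector \<open>g\<close> occurs at all nearby points
  and differentiability of \<open>f\<close> at \<open>x0\<close> suffices. Without a constraint this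
  says that \<open>- g\<close> is a Frechet subgradient. Otherwise the penalized problem is solved
  for slacks \<open>e n\<close> tending to 0, and a subsequence of the normal parts
  converges.\<close>

lemma constrained_first_order_condition:
  fixes J :: "'a::euclidean_space \<Rightarrow> ereal"
  assumes U: "closed U" "convex U" "x0 \<in> U"
    and lip: "U \<noteq> UNIV \<Longrightarrow> lipschitz_around J x0"
    and fin: "\<bar>J x0\<bar> \<noteq> \<infinity>"
    and f: "(f has_derivative (\<lambda>h. g \<bullet> h)) (at x0)"
    and opt: "\<And>x. x \<in> U \<Longrightarrow> J x0 + ereal (f x0) \<le> J x + ereal (f x)"
  obtains \<xi> \<eta> where "\<xi> \<in> limiting_subdifferential J x0" "\<eta> \<in> normal_cone U x0" "g + \<xi> + \<eta> = 0"
proof -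
  have loc: "\<exists>d>0. \<forall>x\<in>U. dist x x0 < d \<longrightarrow> J x0 + ereal (- (g \<bullet> (x - x0)) - e * norm (x - x0)) \<le> J x"
    if e: "e > 0" for e
  proof -
    obtain d where d: "d > 0"
      "\<And>x. norm (x - x0) < d \<Longrightarrow> norm (f x - f x0 - g \<bullet> (x - x0)) \<le> e * norm (x - x0)"
      using f e unfolding has_derivative_at_alt by blast
    have "J x0 + ereal (- (g \<bullet> (x - x0)) - e * norm (x - x0)) \<le> J x" if x: "x \<in> U" "dist x x0 < d" for x
    proof -
      have "\<bar>f x - f x0 - g \<bullet> (x - x0)\<bar> \<le> e * norm (x - x0)" using d(2)[of x] x by (simp add: dist_norm)
      moreover obtain r where "J x0 = ereal r" using fin by auto
      ultimately show ?thesis using opt[OF x(1)] by (cases "J x") auto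
    qed
    with d show ?thesis by blast
  qed
  show ?thesis
  proof (cases "U = UNIV")
    case True
    have "- g \<in> frechet_subdifferential J x0"
    proof (rule mem_frechet_subdifferentialI[where J = J, OF fin])
      fix e :: real assume "e > 0"
      from loc[OF this] True obtain d where "d > 0"
        "\<forall>x. dist x x0 < d \<longrightarrow> J x0 + ereal (- (g \<bullet> (x - x0)) - e * norm (x - x0)) \<le> J x" by auto
      then show "\<forall>\<^sub>F x in at x0. J x0 + ereal (- g \<bullet> (x - x0) - e * norm (x - x0)) \<le> J x"
        by (auto simp: eventually_at)
    qed
    then have "- g \<in> limiting_subdifferential J x0" using frechet_subset_limiting by blast
    moreover have "0 \<in> normal_cone U x0" by (simp add: normal_cone_def)
    ultimately show ?thesis by (rule that) simp
  next
    case False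
    obtain r0 L where r0: "r0 > 0" and finite: "\<forall>y\<in>ball x0 r0. \<bar>J y\<bar> \<noteq> \<infinity>"
      and L: "L-lipschitz_on (ball x0 r0) (\<lambda>y. real_of_ereal (J y))"
      using lip[OF False] unfolding lipschitz_around_def by (elim exE conjE) (rule that)
    define Jr where "Jr y = real_of_ereal (J y)" for y
    have J: "J y = ereal (Jr y)" if "y \<in> ball x0 r0" for y
      using finite that by (simp add: Jr_def ereal_real)
    define e where "e n = inverse (real (Suc n))" for n
    have e: "e n > 0" "e \<longlonglongrightarrow> 0" for n
      unfolding e_def using LIMSEQ_inverse_real_of_nat by auto
    have "\<exists>x y \<eta>. dist x x0 < r0 \<and> dist x x0 \<le> e n \<and> y \<in> U \<and> dist y x0 \<le> e n \<and>
        - g - \<eta> \<in> frechet_subdifferential J x \<and>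
        (\<forall>\<zeta>\<in>U. \<eta> \<bullet> (\<zeta> - y) \<le> 2 * e n * norm (\<zeta> - y)) \<and> norm \<eta> \<le> 2 * (L + norm g)" for n
    proof -
      obtain d where d: "d > 0" "\<And>x. x \<in> U \<Longrightarrow> dist x x0 < d \<Longrightarrow>
          J x0 + ereal (- (g \<bullet> (x - x0)) - e n * norm (x - x0)) \<le> J x"
        using loc[OF e(1)] by blast
      define r where "r = min d r0 / 2"
      have r: "r > 0" "r < r0" "r < d" using d r0 by (auto simp: r_def)
      have "L-lipschitz_on (cball x0 r) Jr"
        using L r unfolding Jr_def by (auto intro: lipschitz_on_subset)
      moreover have "Jr x0 \<le> Jr x + g \<bullet> (x - x0) + e n * norm (x - x0)"
        if "x \<in> U" "x \<in> cball x0 r" for x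
        using d(2)[of x] that r r0 by (simp add: J dist_commute)
      ultimately obtain x y \<eta> where xy: "dist x x0 < r" "dist x x0 \<le> e n" "y \<in> U" "dist y x0 \<le> e n"
        and fr: "\<And>s. s > 0 \<Longrightarrow> \<forall>\<^sub>F z in at x. Jr x + ((- g - \<eta>) \<bullet> (z - x) - s * norm (z - x)) \<le> Jr z"
        and nc: "\<And>\<zeta>. \<zeta> \<in> U \<Longrightarrow> \<eta> \<bullet> (\<zeta> - y) \<le> 2 * e n * norm (\<zeta> - y)" "norm \<eta> \<le> 2 * (L + norm g)"
        using penalized_stationarity[OF U r(1), of L Jr "e n" g] e(1) by blast
      have x: "x \<in> ball x0 r0" using xy r by (simp add: dist_commute)
      have "- g - \<eta> \<in> frechet_subdifferential J x"
      proof (rule mem_frechet_subdifferentialI)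
        show "\<bar>J x\<bar> \<noteq> \<infinity>" using finite x by (rule bspec)
        fix s :: real assume "s > 0"
        then have "\<forall>\<^sub>F z in at x. Jr x + ((- g - \<eta>) \<bullet> (z - x) - s * norm (z - x)) \<le> Jr z" by (rule fr)
        moreover have "\<forall>\<^sub>F z in at x. z \<in> ball x0 r0"
          using x by (intro eventually_at_in_open') auto
        ultimately show "\<forall>\<^sub>F z in at x. J x + ereal ((- g - \<eta>) \<bullet> (z - x) - s * norm (z - x)) \<le> J z"
          by eventually_elim (simp only: J[OF x] J plus_ereal.simps ereal_less_eq)
      qed
      then show ?thesis using xy nc x
        by (intro exI[of _ x] exI[of _ y] exI[of _ \<eta>] conjI ballI) (auto simp: dist_commute)
    qed
    then obtain X Y E where X: "\<And>n. dist (X n) x0 < r0" "\<And>n. dist (X n) x0 \<le> e n"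
      and Y: "\<And>n. Y n \<in> U" "\<And>n. dist (Y n) x0 \<le> e n"
      and fr: "\<And>n. - g - E n \<in> frechet_subdifferential J (X n)"
      and nc: "\<And>n \<zeta>. \<zeta> \<in> U \<Longrightarrow> E n \<bullet> (\<zeta> - Y n) \<le> 2 * e n * norm (\<zeta> - Y n)"
      and E: "\<And>n. norm (E n) \<le> 2 * (L + norm g)"
      by metis
    \<comment> \<open>The penalty weights blow up as \<open>e n\<close> tends to 0; the bound
      survives because it involves only the local Lipschitz constant of \<open>J\<close> and
      \<open>norm g\<close>.\<close>
    have "bounded (range E)" using E by (auto simp: bounded_iff)
    then obtain \<eta> \<rho> where \<rho>: "strict_mono \<rho>" "(E \<circ> \<rho>) \<longlonglongrightarrow> \<eta>"
      using bounded_imp_convergent_subsequence by blast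
    have e\<rho>: "(\<lambda>n. e (\<rho> n)) \<longlonglongrightarrow> 0" using LIMSEQ_subseq_LIMSEQ[OF e(2) \<rho>(1)] by (simp add: o_def)
    have X\<rho>: "(\<lambda>n. X (\<rho> n)) \<longlonglongrightarrow> x0"
      by (rule Lim_null_comparison[OF _ e\<rho>, THEN LIM_zero_cancel]) (use X(2) in \<open>auto simp: dist_norm\<close>)
    have Y\<rho>: "(\<lambda>n. Y (\<rho> n)) \<longlonglongrightarrow> x0"
      by (rule Lim_null_comparison[OF _ e\<rho>, THEN LIM_zero_cancel]) (use Y(2) in \<open>auto simp: dist_norm\<close>)
    have JX: "(\<lambda>n. J (X (\<rho> n))) \<longlonglongrightarrow> J x0"
    proof -
      have "continuous_on (ball x0 r0) Jr" using lipschitz_on_continuous_on[OF L] by (simp add: Jr_def[abs_def])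
      then have "(\<lambda>n. Jr (X (\<rho> n))) \<longlonglongrightarrow> Jr x0"
        using X\<rho> by (rule continuous_on_tendsto_compose) (use X r0 in \<open>auto simp: dist_commute\<close>)
      then show ?thesis using X r0 by (simp add: J dist_commute)
    qed
    have "- g - \<eta> \<in> limiting_subdifferential J x0"
      unfolding limiting_subdifferential_def
    proof (intro CollectI conjI exI)
      show "(\<lambda>n. - g - E (\<rho> n)) \<longlonglongrightarrow> - g - \<eta>" using \<rho>(2) by (intro tendsto_intros) (simp add: o_def)
    qed (use fin X\<rho> JX fr in auto)
    moreover have "\<eta> \<in> normal_cone U x0"
      unfolding normal_cone_def
    proof (intro CollectI ballI)
      fix \<zeta> assume "\<zeta> \<in> U"
      have "(\<lambda>n. E (\<rho> n) \<bullet> (\<zeta> - Y (\<rho> n))) \<longlonglongrightarrow> \<eta> \<bullet> (\<zeta> - x0)"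
        using \<rho>(2) Y\<rho> by (intro tendsto_intros) (auto simp: o_def)
      moreover have "(\<lambda>n. 2 * e (\<rho> n) * norm (\<zeta> - Y (\<rho> n))) \<longlonglongrightarrow> 2 * 0 * norm (\<zeta> - x0)"
        using e\<rho> Y\<rho> by (intro tendsto_intros)
      ultimately have "\<eta> \<bullet> (\<zeta> - x0) \<le> 2 * 0 * norm (\<zeta> - x0)"
        by (rule LIMSEQ_le) (use nc \<open>\<zeta> \<in> U\<close> in auto)
      then show "\<eta> \<bullet> (\<zeta> - x0) \<le> 0" by simp
    qed
    ultimately show ?thesis by (rule that) simp
  qed
qed

lemma lower_semicontinuousD:
  fixes J :: "'a::t1_space \<Rightarrow> ereal"
  assumes "lower_semicontinuous J" and X: "X \<longlonglongrightarrow> x" and c: "c < J x"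
  shows "\<forall>\<^sub>F n in sequentially. c < J (X n)"
proof -
  have "\<forall>\<^sub>F y in at x. c < J y"
    using assms(1) c unfolding lower_semicontinuous_def le_Liminf_iff by blast
  \<comment> \<open>The filter \<open>at x\<close> omits \<open>x\<close>, but the sequence may take
    the value \<open>x\<close>; the assumption \<open>c < J x\<close> covers it.\<close>
  then have "\<forall>\<^sub>F y in nhds x. c < J y"
    using c by (auto simp: eventually_at_filter elim: eventually_mono)
  with X show ?thesis by (auto simp: filterlim_iff)
qed

section \<open>The iterates of NAPP-AL\<close>

lemma sum3_squares_bound: "(a + b + c)\<^sup>2 \<le> 3 * (a\<^sup>2 + b\<^sup>2 + c\<^sup>2)" for a b c :: real
  using sum_squares_ge_zero[of "a - b" "b - c"] zero_le_power2[of "a - c"]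
  by (simp add: power2_eq_square algebra_simps)

lemma sum2_squares_bound: "(a + b)\<^sup>2 \<le> 2 * (a\<^sup>2 + b\<^sup>2)" for a b :: real
  using zero_le_power2[of "a - b"] by (simp add: power2_eq_square algebra_simps)

lemma bounded_range_Suc:
  assumes "bounded (range (\<lambda>k. f (Suc k)))"
  shows "bounded (range f)"
proof (rule bounded_subset)
  show "bounded (insert (f 0) (range (\<lambda>k. f (Suc k))))" using assms by simp
  show "range f \<subseteq> insert (f 0) (range (\<lambda>k. f (Suc k)))"
  proof
    fix y assume "y \<in> range f"
    then obtain k where "y = f k" by auto
    then show "y \<in> insert (f 0) (range (\<lambda>k. f (Suc k)))" by (cases k) auto
  qed
qed

lemma norm_add2_diff: "norm (a + b - c) \<le> norm a + norm b + norm c"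
  for a b c :: "'a::real_normed_vector"
  using norm_triangle_ineq4[of "a + b" c] norm_triangle_ineq[of a b] by linarith

lemma norm_add3_diff: "norm (a + b + c - d) \<le> norm a + norm b + norm c + norm d"
  for a b c d :: "'a::real_normed_vector"
  using norm_add2_diff[of "a + b" c d] norm_triangle_ineq[of a b] by linarith

lemma tendsto_UNIV: "continuous_on UNIV f \<Longrightarrow> X \<longlonglongrightarrow> x \<Longrightarrow> (\<lambda>n. f (X n)) \<longlonglongrightarrow> f x"
  by (rule continuous_on_tendsto_compose) auto

text \<open>Otherwise every \<open>transpose B *v y\<close> is rewritten to \<open>y v* B\<close>, for which hardly any lemma is available.\<close>

declare transpose_matrix_vector [simp del]

locale napp_al_run =
  fixes U :: "(real^'n) set"
    and G :: "(real^'n) \<times> (real^'d) \<Rightarrow> real"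
    and J :: "real^'n \<Rightarrow> ereal"
    and H :: "real^'d \<Rightarrow> real"
    and \<Omega> \<Phi> \<Theta> :: "real^'n \<Rightarrow> real^'m"
    and B :: "real^'d^'m"
    and K :: "real^'n \<Rightarrow> real"
    and L\<^sub>G L\<^sub>H L\<Theta> L\<Omega> L\<^sub>K \<beta> \<gamma> \<sigma> lmin :: real
    and L\<Omega>c :: "'m \<Rightarrow> real"
    and \<delta> \<epsilon> :: "nat \<Rightarrow> real"
    and u :: "nat \<Rightarrow> real^'n" and v :: "nat \<Rightarrow> real^'d" and p q :: "nat \<Rightarrow> real^'m"
  assumes U: "closed U" "convex U"
    and \<Theta>_def: "\<Theta> = (\<lambda>x. \<Omega> x + \<Phi> x)"
    and \<Omega>_diff: "\<And>x. \<Omega> differentiable (at x)"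
    and \<Phi>_diff: "\<And>x. \<Phi> differentiable (at x)"
    and G_diff: "\<And>z. G differentiable (at z)" and G_lip: "L\<^sub>G-lipschitz_on UNIV (grad G)"
    and H_diff: "\<And>y. H differentiable (at y)" and H_lip: "L\<^sub>H-lipschitz_on UNIV (grad H)"
    and J_proper: "proper_ereal J" and J_lsc: "lower_semicontinuous J"
    and J_lip: "U \<noteq> UNIV \<Longrightarrow> \<forall>x\<in>edom J \<inter> U. lipschitz_around J x"
    and \<Theta>_lip: "L\<Theta>-lipschitz_on UNIV \<Theta>"
    and \<Omega>_lip: "\<And>j. (L\<Omega>c j)-lipschitz_on UNIV (grad (\<lambda>x. \<Omega> x $ j))"
    and L\<Omega>: "L\<Omega> = (\<Sum>j\<in>UNIV. L\<Omega>c j)"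
    and B_inj: "inj ((*v) B)" and B_range: "range \<Theta> \<subseteq> range ((*v) B)"
    and F_bdd: "\<exists>c::real. \<forall>(x, y)\<in>{(x, y). \<Theta> x + B *v y = 0}. ereal c \<le> objective G J H (x, y)"
    and F_coercive: "(objective G J H \<longlongrightarrow> \<infinity>)
               (inf at_infinity (principal {(x, y). \<Theta> x + B *v y = 0}))"
    and K_diff: "\<And>x. K differentiable (at x)" and K_sc: "\<beta> > 0" "strongly_convex \<beta> K"
    and K_lip: "L\<^sub>K-lipschitz_on UNIV (grad K)"
    and lmin: "lmin = lambda_min (transpose B ** B)"
    and \<gamma>: "\<gamma> > (sqrt 57 + 1) / (2 * lmin) * (L\<^sub>G + L\<^sub>H)" "\<gamma> > 0"
    and \<sigma>: "0 < \<sigma>" "\<sigma> < 1"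
    and algorithm: "napp_al U G J H \<Omega> \<Phi> B K \<gamma> \<sigma> \<delta> \<epsilon> u v p q"
    and \<delta>: "\<And>k. \<delta> k = \<beta> * inverse
              (L\<^sub>G + norm (q k) * L\<Omega> + \<gamma> * L\<Theta>\<^sup>2
               + 14 * \<gamma> * (spectral_norm B)\<^sup>2 * L\<Theta>\<^sup>2 / lmin
               + 14 * (L\<^sub>G + \<gamma> * spectral_norm B * L\<Theta>)\<^sup>2 / (\<gamma> * lmin) + 1)"
begin

abbreviation "b \<equiv> spectral_norm B"
text \<open>\<open>m\<close> and \<open>s\<close> are the factors of the previous \<open>u\<close>-
  and \<open>v\<close>-step in \<open>dual_step_bound\<close>; their squares reappear in the
  constants \<open>c\<^sub>1\<close> and \<open>c\<^sub>2\<close>.\<close>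

abbreviation "s \<equiv> L\<^sub>G + L\<^sub>H"
abbreviation "m \<equiv> L\<^sub>G + \<gamma> * b * L\<Theta>"

definition res :: "nat \<Rightarrow> real^'m" where "res k = \<Theta> (u k) + B *v v k"

definition Jr :: "real^'n \<Rightarrow> real" where "Jr x = real_of_ereal (J x)"

definition gradv :: "real^'n \<Rightarrow> real^'d \<Rightarrow> real^'d" where
  "gradv x y = grad_snd G x y + grad H y"

lemma consts_nonneg: "0 \<le> L\<^sub>G" "0 \<le> L\<^sub>H" "0 \<le> L\<Theta>" "0 \<le> L\<Omega>" "0 \<le> L\<^sub>K" "0 \<le> b" "0 \<le> s" "0 \<le> m"
proof -
  show *: "0 \<le> L\<^sub>G" "0 \<le> L\<^sub>H" "0 \<le> L\<Theta>" "0 \<le> L\<^sub>K" "0 \<le> b"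
    using G_lip H_lip \<Theta>_lip K_lip spectral_norm_nonneg by (auto dest: lipschitz_on_nonneg)
  show "0 \<le> L\<Omega>" unfolding L\<Omega> by (intro sum_nonneg lipschitz_on_nonneg[OF \<Omega>_lip])
  show "0 \<le> s" "0 \<le> m" using * \<gamma> by auto
qed

lemma lmin_pos: "0 < lmin"
  unfolding lmin by (rule lambda_min_gram[OF B_inj])

lemma lmin_le: "lmin * (norm x)\<^sup>2 \<le> (norm (B *v x))\<^sup>2"
  unfolding lmin by (rule lambda_min_gram[OF B_inj])

lemma lmin_le_transpose: "r \<in> range ((*v) B) \<Longrightarrow> lmin * (norm r)\<^sup>2 \<le> (norm (transpose B *v r))\<^sup>2"
  unfolding lmin by (rule norm_transpose_mult_ge[OF B_inj])

lemma lmin_le_b: "lmin \<le> b\<^sup>2"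
proof -
  have "lmin * (norm (axis undefined 1 :: real^'d))\<^sup>2 \<le> (b * norm (axis undefined 1 :: real^'d))\<^sup>2"
    by (rule order_trans[OF lmin_le]) (intro power_mono norm_mult_le_spectral_norm norm_ge_zero)
  then show ?thesis by (simp add: norm_axis_1)
qed

lemma norm_B_le: "norm (B *v x) \<le> b * norm x" "norm (transpose B *v y) \<le> b * norm y"
  by (intro norm_mult_le_spectral_norm norm_transpose_mult_le)+

text \<open>\<open>sqrt 57 \<ge> 7\<close> makes the factor \<open>(sqrt 57 + 1) / 2\<close> at
  least 4. In this form the condition on \<gamma> enters both the descent and the lower
  bound.\<close>

lemma gamma_lmin: "4 * s \<le> \<gamma> * lmin"
proof -
  have "7 \<le> sqrt 57" by (rule real_le_rsqrt) simp
  then have "4 * s / lmin \<le> (sqrt 57 + 1) / (2 * lmin) * s"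
    using mult_right_mono[OF divide_right_mono[of 8 "sqrt 57 + 1" "2 * lmin"] consts_nonneg(7)] lmin_pos
    by simp
  also have "\<dots> < \<gamma>" by (rule \<gamma>)
  finally show ?thesis using lmin_pos by (simp add: field_simps)
qed

lemma gamma_lmin_pos: "0 < \<gamma> * lmin" using \<gamma> lmin_pos by simp

lemma \<Theta>_bound: "norm (\<Theta> x - \<Theta> y) \<le> L\<Theta> * norm (x - y)"
  using lipschitz_onD[OF \<Theta>_lip, of x y] by (simp add: dist_norm)

lemma res_range: "res k \<in> range ((*v) B)"
proof -
  obtain y where "\<Theta> (u k) = B *v y" using B_range by blast
  then have "res k = B *v (y + v k)" by (simp add: res_def matrix_vector_right_distrib)
  then show ?thesis by simp
qed

lemma q_eq: "q k = p k + \<gamma> *\<^sub>R res k"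
  unfolding res_def unfolding \<Theta>_def using algorithm by (simp add: napp_al_def)

lemma p_Suc: "p (Suc k) = p k + \<gamma> *\<^sub>R res (Suc k)"
  unfolding res_def unfolding \<Theta>_def using algorithm by (simp add: napp_al_def)

lemma u_mem: "u (Suc k) \<in> U"
  using algorithm by (simp add: napp_al_def is_arg_min_def)

lemma p_diff_range: "p (Suc k) - p k \<in> range ((*v) B)"
proof -
  obtain y where "res (Suc k) = B *v y" using res_range by blast
  then have "p (Suc k) - p k = B *v (\<gamma> *\<^sub>R y)" by (simp add: p_Suc matrix_vector_mult_scaleR)
  then show ?thesis by simp
qed

text \<open>The part of the \<open>u\<close>-subproblem besides \<open>J\<close>. The weight
  \<open>t\<close> of the Bregman term is a parameter so that \<open>1 / \<epsilon> k\<close> can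
  later be replaced by a uniform bound, or by 0.\<close>

definition usub :: "real^'n \<Rightarrow> real^'d \<Rightarrow> real^'m \<Rightarrow> real \<Rightarrow> real^'n \<Rightarrow> real" where
  "usub x0 y0 q0 t x = grad_fst G x0 y0 \<bullet> x + q0 \<bullet> (jacobian \<Omega> (at x0) *v x + \<Phi> x) + t * bregman K x x0"

lemma u_subproblem_eq:
  "u_subproblem G J \<Omega> \<Phi> K (u k) (v k) (q k) (\<epsilon> k) x = J x + ereal (usub (u k) (v k) (q k) (1 / \<epsilon> k) x)"
proof -
  have "J x \<noteq> -\<infinity>" using J_proper by (simp add: proper_ereal_def)
  then show ?thesis by (cases "J x") (auto simp: u_subproblem_def usub_def)
qed

text \<open>Finiteness comes from the requirement that the minimum value be finite, so it holds from
  index one on and says nothing about \<open>u 0\<close>.\<close>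

lemma J_finite: "\<bar>J (u (Suc k))\<bar> \<noteq> \<infinity>"
proof -
  have "J (u (Suc k)) \<noteq> -\<infinity>" using J_proper by (simp add: proper_ereal_def)
  moreover have "J (u (Suc k)) + ereal (usub (u k) (v k) (q k) (1 / \<epsilon> k) (u (Suc k))) < \<infinity>"
    using algorithm unfolding napp_al_def u_subproblem_eq by blast
  ultimately show ?thesis by auto
qed

lemma J_u: "J (u (Suc k)) = ereal (Jr (u (Suc k)))"
  using J_finite[of k] by (simp add: Jr_def ereal_real)

lemma u_opt:
  assumes "x \<in> U"
  shows "J (u (Suc k)) + ereal (usub (u k) (v k) (q k) (1 / \<epsilon> k) (u (Suc k)))
    \<le> J x + ereal (usub (u k) (v k) (q k) (1 / \<epsilon> k) x)"
  using algorithm assms unfolding napp_al_def u_subproblem_eq is_arg_min_linorder by blast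

section \<open>Optimality of the \<open>v\<close>-step and the multiplier identity\<close>

lemma v_opt: "gradv (u k) (v k) + transpose B *v (q k + \<gamma> *\<^sub>R (B *v (v (Suc k) - v k))) = 0"
proof -
  let ?f = "v_subproblem G H B \<gamma> (u k) (v k) (q k)"
  let ?y = "v (Suc k)"
  let ?g = "gradv (u k) (v k) + transpose B *v (q k + \<gamma> *\<^sub>R (B *v (?y - v k)))"
  have min: "?f ?y \<le> ?f y" for y
    using algorithm unfolding napp_al_def is_arg_min_linorder by blast
  have f: "?f = (\<lambda>y. gradv (u k) (v k) \<bullet> y + q k \<bullet> (B *v y) + \<gamma> / 2 * ((B *v (y - v k)) \<bullet> (B *v (y - v k))))"
    by (simp add: fun_eq_iff v_subproblem_def gradv_def power2_norm_eq_inner)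
  have "(?f has_derivative (\<lambda>h. gradv (u k) (v k) \<bullet> h + q k \<bullet> (B *v h)
      + \<gamma> / 2 * ((B *v (?y - v k)) \<bullet> (B *v h) + (B *v h) \<bullet> (B *v (?y - v k))))) (at ?y)"
    unfolding f
    by (auto intro!: derivative_eq_intros bounded_linear.has_derivative[OF matrix_vector_mul_bounded_linear])
  also have "(\<lambda>h. gradv (u k) (v k) \<bullet> h + q k \<bullet> (B *v h)
      + \<gamma> / 2 * ((B *v (?y - v k)) \<bullet> (B *v h) + (B *v h) \<bullet> (B *v (?y - v k)))) = (\<lambda>h. ?g \<bullet> h)"
    by (rule ext) (simp add: inner_add_left inner_add_right inner_transpose_mult
        inner_commute[of "B *v _" "B *v (v (Suc k) - v k)"])
  finally have "(?f has_derivative (\<lambda>h. ?g \<bullet> h)) (at ?y)" .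
  from has_derivative_local_min[OF this] min have "(\<lambda>h. ?g \<bullet> h) = (\<lambda>h. 0)" by auto
  then have "?g \<bullet> ?g = 0" by (metis (no_types))
  then show ?thesis by simp
qed

text \<open>The vector annihilated in \<open>v_opt\<close> is almost \<open>p (Suc k)\<close>: it
  contains \<Theta> at the old \<open>u k\<close>, whereas the multiplier update uses
  \<open>u (Suc k)\<close>. The difference is the last term.\<close>

lemma dual_eq:
  "transpose B *v p (Suc k) = - gradv (u k) (v k) + \<gamma> *\<^sub>R (transpose B *v (\<Theta> (u (Suc k)) - \<Theta> (u k)))"
proof -
  let ?a = "q k + \<gamma> *\<^sub>R (B *v (v (Suc k) - v k))"
  have "p (Suc k) = ?a + \<gamma> *\<^sub>R (\<Theta> (u (Suc k)) - \<Theta> (u k))"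
    by (simp add: q_eq p_Suc res_def algebra_simps matrix_vector_mult_diff_distrib)
  then have "transpose B *v p (Suc k)
      = transpose B *v ?a + \<gamma> *\<^sub>R (transpose B *v (\<Theta> (u (Suc k)) - \<Theta> (u k)))"
    by (simp only: matrix_vector_right_distrib matrix_vector_mult_scaleR)
  moreover have "transpose B *v ?a = - gradv (u k) (v k)"
    using v_opt[of k] by (metis add_eq_0_iff)
  ultimately show ?thesis by simp
qed

lemma grad_G_diff:
  "norm (grad G (x, y) - grad G (x', y')) \<le> L\<^sub>G * (norm (x - x') + norm (y - y'))"
proof -
  have "norm (grad G (x, y) - grad G (x', y')) \<le> L\<^sub>G * norm (x - x', y - y')"
    using lipschitz_onD[OF G_lip, of "(x, y)" "(x', y')"] by (simp add: dist_norm)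
  also have "\<dots> \<le> L\<^sub>G * (norm (x - x') + norm (y - y'))"
    by (intro mult_left_mono norm_Pair_le consts_nonneg)
  finally show ?thesis .
qed

lemma grad_fst_diff:
  "norm (grad_fst G x y - grad_fst G x' y') \<le> L\<^sub>G * (norm (x - x') + norm (y - y'))"
  using grad_G_diff[of x y x' y'] norm_fst_le order_trans
  by (fastforce simp: grad_Pair[OF G_diff])

lemma gradv_diff: "norm (gradv x y - gradv x' y') \<le> L\<^sub>G * norm (x - x') + s * norm (y - y')"
proof -
  have "norm (grad_snd G x y - grad_snd G x' y') \<le> L\<^sub>G * (norm (x - x') + norm (y - y'))"
    using grad_G_diff[of x y x' y'] norm_snd_le order_trans
    by (fastforce simp: grad_Pair[OF G_diff])
  moreover have "norm (grad H y - grad H y') \<le> L\<^sub>H * norm (y - y')"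
    using lipschitz_onD[OF H_lip, of y y'] by (simp add: dist_norm)
  moreover have "norm (gradv x y - gradv x' y')
      \<le> norm (grad_snd G x y - grad_snd G x' y') + norm (grad H y - grad H y')"
    unfolding gradv_def add_diff_add by (rule norm_triangle_ineq)
  ultimately show ?thesis by (simp add: algebra_simps)
qed

abbreviation "du k \<equiv> norm (u (Suc k) - u k)"
abbreviation "dv k \<equiv> norm (v (Suc k) - v k)"

lemma transpose_B_\<Theta>:
  "norm (\<gamma> *\<^sub>R (transpose B *v (\<Theta> x - \<Theta> y))) \<le> \<gamma> * b * L\<Theta> * norm (x - y)"
proof -
  have "norm (transpose B *v (\<Theta> x - \<Theta> y)) \<le> b * (L\<Theta> * norm (x - y))"
    using norm_B_le(2) mult_left_mono[OF \<Theta>_bound consts_nonneg(6)] by (rule order_trans)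
  then show ?thesis using \<gamma> by (simp add: mult.assoc mult_left_mono)
qed

text \<open>Two consecutive instances of \<open>dual_eq\<close> are subtracted. The gradient
  difference and the older \<Theta>-increment both involve \<open>du k\<close>, which explains
  \<open>m\<close>; the newer increment contributes \<open>du (Suc k)\<close>.\<close>

lemma dual_step_bound:
  "lmin * (norm (p (Suc (Suc k)) - p (Suc k)))\<^sup>2
    \<le> 3 * ((m * du k)\<^sup>2 + (s * dv k)\<^sup>2 + (\<gamma> * b * L\<Theta> * du (Suc k))\<^sup>2)"
proof -
  let ?X = "gradv (u k) (v k) - gradv (u (Suc k)) (v (Suc k))"
  let ?Y = "\<gamma> *\<^sub>R (transpose B *v (\<Theta> (u (Suc (Suc k))) - \<Theta> (u (Suc k))))"
  let ?Z = "\<gamma> *\<^sub>R (transpose B *v (\<Theta> (u (Suc k)) - \<Theta> (u k)))"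
  have eq: "transpose B *v (p (Suc (Suc k)) - p (Suc k)) = ?X + ?Y - ?Z"
    by (simp add: matrix_vector_mult_diff_distrib dual_eq)
  have "norm (?X + ?Y - ?Z) \<le> norm ?X + norm ?Y + norm ?Z"
    by (rule order_trans[OF norm_triangle_ineq4 add_right_mono[OF norm_triangle_ineq]])
  also have "\<dots> \<le> (L\<^sub>G * du k + s * dv k) + \<gamma> * b * L\<Theta> * du (Suc k) + \<gamma> * b * L\<Theta> * du k"
    using gradv_diff[of "u k" "v k" "u (Suc k)" "v (Suc k)"]
    by (intro add_mono transpose_B_\<Theta>) (simp add: norm_minus_commute)
  also have "\<dots> = m * du k + s * dv k + \<gamma> * b * L\<Theta> * du (Suc k)" by (simp add: algebra_simps)
  finally have "(norm (transpose B *v (p (Suc (Suc k)) - p (Suc k))))\<^sup>2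
      \<le> (m * du k + s * dv k + \<gamma> * b * L\<Theta> * du (Suc k))\<^sup>2"
    unfolding eq by (rule power_mono) simp
  also have "\<dots> \<le> 3 * ((m * du k)\<^sup>2 + (s * dv k)\<^sup>2 + (\<gamma> * b * L\<Theta> * du (Suc k))\<^sup>2)"
    by (rule sum3_squares_bound)
  finally show ?thesis using lmin_le_transpose[OF p_diff_range] by (rule order_trans[rotated])
qed

section \<open>Step sizes and descent of the Lyapunov function\<close>

definition step_denom :: "nat \<Rightarrow> real" where
  "step_denom k = L\<^sub>G + norm (q k) * L\<Omega> + \<gamma> * L\<Theta>\<^sup>2 + 14 * \<gamma> * b\<^sup>2 * L\<Theta>\<^sup>2 / lmin + 14 * m\<^sup>2 / (\<gamma> * lmin) + 1"

lemma step_denom_pos: "1 \<le> step_denom k"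
  using consts_nonneg \<gamma> lmin_pos by (simp add: step_denom_def)

text \<open>The lower bound on \<open>1 / \<epsilon> k\<close> gives descent; the upper one, which
  depends on \<sigma>, is needed for the residual and for the limit in the subproblem.\<close>

lemma step_size_bounds: "\<epsilon> k > 0" "step_denom k / \<beta> \<le> 1 / \<epsilon> k" "1 / \<epsilon> k \<le> step_denom k / (\<sigma> * \<beta>)"
proof -
  have d: "\<delta> k = \<beta> / step_denom k" by (simp add: \<delta> step_denom_def divide_inverse)
  have e: "\<sigma> * \<delta> k \<le> \<epsilon> k" "\<epsilon> k \<le> \<delta> k" using algorithm by (auto simp: napp_al_def)
  have dpos: "0 < \<delta> k" using step_denom_pos[of k] K_sc by (simp add: d)
  then show pos: "\<epsilon> k > 0" using e \<sigma> by (smt (verit) mult_pos_pos)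
  have "1 / \<delta> k \<le> 1 / \<epsilon> k" using e pos dpos by (intro divide_left_mono) auto
  then show "step_denom k / \<beta> \<le> 1 / \<epsilon> k" by (simp add: d)
  have "1 / \<epsilon> k \<le> 1 / (\<sigma> * \<delta> k)" using e pos dpos \<sigma> by (intro divide_left_mono) auto
  then show "1 / \<epsilon> k \<le> step_denom k / (\<sigma> * \<beta>)" by (simp add: d)
qed

definition Lr :: "real^'n \<Rightarrow> real^'d \<Rightarrow> real^'m \<Rightarrow> real" where
  "Lr x y z = G (x, y) + Jr x + H y + z \<bullet> (\<Theta> x + B *v y) + \<gamma> / 2 * (norm (\<Theta> x + B *v y))\<^sup>2"

text \<open>The \<open>u\<close>-subproblem is compared with its own starting point, which must lie
  in \<open>U\<close> with finite \<open>J\<close>; hence the indices begin at \<open>Suc k\<close>.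
  In \<open>v\<close>, optimality cancels all first-order terms and leaves minus \<gamma> times the
  squared step under \<open>B\<close>.\<close>

lemma primal_descent:
  "Lr (u (Suc (Suc k))) (v (Suc (Suc k))) (p (Suc k)) \<le> Lr (u (Suc k)) (v (Suc k)) (p (Suc k))
    + (L\<^sub>G + norm (q (Suc k)) * L\<Omega> - step_denom (Suc k)) / 2 * (du (Suc k))\<^sup>2 + s / 2 * (dv (Suc k))\<^sup>2
    - \<gamma> * (norm (B *v (v (Suc (Suc k)) - v (Suc k))))\<^sup>2
    + \<gamma> / 2 * (norm (\<Theta> (u (Suc (Suc k))) - \<Theta> (u (Suc k)) + B *v (v (Suc (Suc k)) - v (Suc k))))\<^sup>2"
proof -
  define x y z where "x = u (Suc k)" "y = v (Suc k)" "z = q (Suc k)"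
  define x' y' where "x' = u (Suc (Suc k))" "y' = v (Suc (Suc k))"
  note defs = x_y_z_def x'_y'_def
  have G: "G (x', y') \<le> G (x, y) + grad_fst G x y \<bullet> (x' - x) + grad_snd G x y \<bullet> (y' - y)
      + L\<^sub>G / 2 * ((norm (x' - x))\<^sup>2 + (norm (y' - y))\<^sup>2)"
    using lipschitz_grad_upper_bound[OF G_diff G_lip, of "(x', y')" "(x, y)"]
    by (simp add: grad_Pair[OF G_diff] norm_Pair)
  have H: "H y' \<le> H y + grad H y \<bullet> (y' - y) + L\<^sub>H / 2 * (norm (y' - y))\<^sup>2"
    by (rule lipschitz_grad_upper_bound[OF H_diff H_lip])
  have J: "Jr x' + usub x y z (1 / \<epsilon> (Suc k)) x' \<le> Jr x + usub x y z (1 / \<epsilon> (Suc k)) x"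
    using u_opt[OF u_mem, of "Suc k" k] unfolding defs J_u by simp
  have D: "step_denom (Suc k) / 2 * (norm (x' - x))\<^sup>2 \<le> 1 / \<epsilon> (Suc k) * bregman K x' x"
  proof -
    have "step_denom (Suc k) / \<beta> * (\<beta> / 2 * (norm (x' - x))\<^sup>2) \<le> 1 / \<epsilon> (Suc k) * bregman K x' x"
      using K_sc step_denom_pos[of "Suc k"] less_imp_le[OF step_size_bounds(1)]
      by (intro mult_mono bregman_lower_bound[OF K_diff] step_size_bounds) auto
    then show ?thesis using K_sc by simp
  qed
  \<comment> \<open>The subproblem linearizes \<Omega> but keeps \<Phi>. The linearization error is
    weighted by the shifted multiplier, which is why the step size depends on
    \<open>norm (q k)\<close>.\<close>
  have O: "z \<bullet> (\<Omega> x' - \<Omega> x - jacobian \<Omega> (at x) *v (x' - x)) \<le> norm z * L\<Omega> / 2 * (norm (x' - x))\<^sup>2"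
  proof -
    have "z \<bullet> (\<Omega> x' - \<Omega> x - jacobian \<Omega> (at x) *v (x' - x))
        \<le> norm z * norm (\<Omega> x' - \<Omega> x - jacobian \<Omega> (at x) *v (x' - x))" by (rule norm_cauchy_schwarz)
    also have "\<dots> \<le> norm z * (L\<Omega> / 2 * (norm (x' - x))\<^sup>2)"
      unfolding L\<Omega> by (intro mult_left_mono jacobian_taylor_bound \<Omega>_diff \<Omega>_lip) auto
    finally show ?thesis by simp
  qed
  have V: "grad_snd G x y \<bullet> (y' - y) + grad H y \<bullet> (y' - y) + z \<bullet> (B *v (y' - y)) = - \<gamma> * (norm (B *v (y' - y)))\<^sup>2"
  proof -
    have "(gradv x y + transpose B *v (z + \<gamma> *\<^sub>R (B *v (y' - y)))) \<bullet> (y' - y) = 0"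
      using v_opt[of "Suc k"] by (simp add: defs)
    then show ?thesis
      by (simp add: gradv_def inner_add_left inner_transpose_mult power2_norm_eq_inner)
  qed
  \<comment> \<open>Exact expansion about the old residual \<open>a\<close>: the increment
    \<open>c\<close> has the linear coefficient \<open>p (Suc k) + \<gamma> *\<^sub>R a\<close>,
    which is the shifted multiplier.\<close>
  have R: "p (Suc k) \<bullet> (\<Theta> x' + B *v y') + \<gamma> / 2 * (norm (\<Theta> x' + B *v y'))\<^sup>2
      = p (Suc k) \<bullet> (\<Theta> x + B *v y) + \<gamma> / 2 * (norm (\<Theta> x + B *v y))\<^sup>2
       + z \<bullet> (\<Theta> x' - \<Theta> x) + z \<bullet> (B *v (y' - y))
       + \<gamma> / 2 * (norm (\<Theta> x' - \<Theta> x + B *v (y' - y)))\<^sup>2"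
  proof -
    have "z = p (Suc k) + \<gamma> *\<^sub>R (\<Theta> x + B *v y)" by (simp add: defs q_eq res_def)
    moreover define a where "a = \<Theta> x + B *v y"
    moreover define c where "c = \<Theta> x' - \<Theta> x + B *v (y' - y)"
    moreover have "\<Theta> x' + B *v y' = a + c"
      by (simp add: a_def c_def matrix_vector_mult_diff_distrib)
    moreover have "z \<bullet> (\<Theta> x' - \<Theta> x) + z \<bullet> (B *v (y' - y)) = z \<bullet> c"
      by (simp add: c_def inner_add_right)
    ultimately show ?thesis
      unfolding power2_norm_eq_inner by (simp add: inner_simps inner_commute algebra_simps)
  qed
  have T: "z \<bullet> (\<Theta> x' - \<Theta> x) = z \<bullet> (\<Omega> x' - \<Omega> x) + z \<bullet> (\<Phi> x' - \<Phi> x)"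
    by (simp add: \<Theta>_def inner_simps)
  have J': "Jr x' + grad_fst G x y \<bullet> (x' - x) + z \<bullet> (jacobian \<Omega> (at x) *v (x' - x)) + z \<bullet> (\<Phi> x' - \<Phi> x)
      + 1 / \<epsilon> (Suc k) * bregman K x' x \<le> Jr x"
  proof -
    have "bregman K x x = 0" by (simp add: bregman_def)
    with J show ?thesis
      by (simp add: usub_def inner_simps matrix_vector_mult_diff_distrib)
  qed
  have sums: "L\<^sub>G / 2 * ((norm (x' - x))\<^sup>2 + (norm (y' - y))\<^sup>2) + L\<^sub>H / 2 * (norm (y' - y))\<^sup>2
      + norm z * L\<Omega> / 2 * (norm (x' - x))\<^sup>2 - step_denom (Suc k) / 2 * (norm (x' - x))\<^sup>2
      = (L\<^sub>G + norm z * L\<Omega> - step_denom (Suc k)) / 2 * (norm (x' - x))\<^sup>2 + s / 2 * (norm (y' - y))\<^sup>2"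
    by (simp add: algebra_simps add_divide_distrib diff_divide_distrib)
  have "Lr x' y' (p (Suc k)) \<le> Lr x y (p (Suc k))
      + ((L\<^sub>G + norm z * L\<Omega> - step_denom (Suc k)) / 2 * (norm (x' - x))\<^sup>2 + s / 2 * (norm (y' - y))\<^sup>2)
    - \<gamma> * (norm (B *v (y' - y)))\<^sup>2 + \<gamma> / 2 * (norm (\<Theta> x' - \<Theta> x + B *v (y' - y)))\<^sup>2"
    using G H J' D O[unfolded inner_diff_right[of z]] V R T[unfolded inner_diff_right[of z]]
    unfolding sums[symmetric] Lr_def inner_diff_right[of z] by linarith
  then show ?thesis unfolding defs by simp
qed

text \<open>
  The constant 3 suffices for the descent, while \<open>\<Lambda>\<close> uses 7 and an additional multiplier term. All these
  terms vanish in the limit, so both functions have the same limit.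
\<close>

definition Psi :: "nat \<Rightarrow> real" where
  "Psi k = Lr (u (Suc k)) (v (Suc k)) (p (Suc k))
     + 3 * (m\<^sup>2 / (\<gamma> * lmin)) * (du k)\<^sup>2 + 3 * (s\<^sup>2 / (\<gamma> * lmin)) * (dv k)\<^sup>2"

text \<open>The balance in the \<open>u\<close>-step: the squared \<Theta>-increment costs
  \<open>9 / 2\<close>, less \<open>1 / 2\<close> from the step size, hence 4 multiples of
  \<open>W\<close> by \<open>h8\<close>; the multiplier costs 3 more, and the step size supplies 7.
  In the \<open>v\<close>-step, \<open>- 7 / 16\<close> of \<open>g * c\<close> faces at most
  \<open>5 / 16\<close>, leaving \<open>- 1 / 8\<close>.\<close>

lemma Psi_descent:
  "Psi (Suc k) \<le> Psi k - 1 / 2 * (du (Suc k))\<^sup>2 - \<gamma> * lmin / 8 * (dv (Suc k))\<^sup>2"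
proof -
  define g where "g = \<gamma> * lmin"
  define a c where "a = (du (Suc k))\<^sup>2" and "c = (dv (Suc k))\<^sup>2"
  define X Y where "X = norm (\<Theta> (u (Suc (Suc k))) - \<Theta> (u (Suc k)))"
    and "Y = norm (B *v (v (Suc (Suc k)) - v (Suc k)))"
  define W M S where "W = \<gamma> * b\<^sup>2 * L\<Theta>\<^sup>2 / lmin" and "M = m\<^sup>2 / g" and "S = s\<^sup>2 / g"
  have ac: "0 \<le> a" "0 \<le> c" by (auto simp: a_def c_def)
  have g: "0 < g" "4 * s \<le> g" using gamma_lmin_pos gamma_lmin by (auto simp: g_def)
  have "M \<ge> 0" using g by (simp add: M_def)
  then have Ma: "0 \<le> M * a" using ac by simp
  have h2: "\<gamma> / 2 * (norm (\<Theta> (u (Suc (Suc k))) - \<Theta> (u (Suc k)) + B *v (v (Suc (Suc k)) - v (Suc k))))\<^sup>2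
      \<le> 9 / 2 * (\<gamma> * X\<^sup>2) + 9 / 16 * (\<gamma> * Y\<^sup>2)"
  proof -
    have "(norm (\<Theta> (u (Suc (Suc k))) - \<Theta> (u (Suc k)) + B *v (v (Suc (Suc k)) - v (Suc k))))\<^sup>2 \<le> (X + Y)\<^sup>2"
      unfolding X_def Y_def by (intro power_mono norm_triangle_ineq) simp
    \<comment> \<open>The uneven Young weights keep the \<open>Y\<close>-part below the available
      \<gamma> times \<open>Y\<^sup>2\<close>, while the \<open>X\<close>-part exactly exhausts the
      supply of 7 multiples of \<open>W\<close>.\<close>
    also have "\<dots> \<le> 9 * X\<^sup>2 + 9 / 8 * Y\<^sup>2"
      using zero_le_power2[of "8 * X - Y"] by (simp add: power2_eq_square algebra_simps)
    finally have "\<gamma> / 2 * (norm (\<Theta> (u (Suc (Suc k))) - \<Theta> (u (Suc k)) + B *v (v (Suc (Suc k)) - v (Suc k))))\<^sup>2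
        \<le> \<gamma> / 2 * (9 * X\<^sup>2 + 9 / 8 * Y\<^sup>2)" using \<gamma>(2) by (intro mult_left_mono) auto
    also have "\<dots> = 9 / 2 * (\<gamma> * X\<^sup>2) + 9 / 16 * (\<gamma> * Y\<^sup>2)" by (simp add: algebra_simps)
    finally show ?thesis .
  qed
  have h3: "\<gamma> * X\<^sup>2 \<le> \<gamma> * L\<Theta>\<^sup>2 * a"
  proof -
    have "X\<^sup>2 \<le> (L\<Theta> * du (Suc k))\<^sup>2" unfolding X_def by (intro power_mono \<Theta>_bound) simp
    then show ?thesis using \<gamma> by (simp add: a_def power_mult_distrib mult.assoc)
  qed
  have h4: "g * c \<le> \<gamma> * Y\<^sup>2"
    using lmin_le[of "v (Suc (Suc k)) - v (Suc k)"] \<gamma> by (simp add: g_def c_def Y_def mult.assoc)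
  have h5: "1 / \<gamma> * (norm (p (Suc (Suc k)) - p (Suc k)))\<^sup>2
      \<le> 3 * (M * (du k)\<^sup>2) + 3 * (S * (dv k)\<^sup>2) + 3 * (W * a)"
  proof -
    have "1 / \<gamma> * (norm (p (Suc (Suc k)) - p (Suc k)))\<^sup>2
        = lmin * (norm (p (Suc (Suc k)) - p (Suc k)))\<^sup>2 / g"
      using lmin_pos by (simp add: g_def)
    also have "\<dots> \<le> 3 * ((m * du k)\<^sup>2 + (s * dv k)\<^sup>2 + (\<gamma> * b * L\<Theta> * du (Suc k))\<^sup>2) / g"
      using dual_step_bound g by (intro divide_right_mono) auto
    also have "\<dots> = 3 * (M * (du k)\<^sup>2) + 3 * (S * (dv k)\<^sup>2) + 3 * ((\<gamma> * b * L\<Theta>)\<^sup>2 / g * a)"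
      by (simp add: M_def S_def a_def power_mult_distrib add_divide_distrib)
    also have "(\<gamma> * b * L\<Theta>)\<^sup>2 / g = W"
      using \<gamma> by (simp add: W_def g_def power_mult_distrib power2_eq_square)
    finally show ?thesis .
  qed
  \<comment> \<open>The multiplier update is an ascent step: the new residual is the multiplier step
    divided by \<gamma>.\<close>
  have h6: "Lr (u (Suc (Suc k))) (v (Suc (Suc k))) (p (Suc (Suc k)))
      = Lr (u (Suc (Suc k))) (v (Suc (Suc k))) (p (Suc k)) + 1 / \<gamma> * (norm (p (Suc (Suc k)) - p (Suc k)))\<^sup>2"
  proof -
    have "res (Suc (Suc k)) = (1 / \<gamma>) *\<^sub>R (p (Suc (Suc k)) - p (Suc k))"
      using \<gamma> by (simp add: p_Suc)
    then have "(p (Suc (Suc k)) - p (Suc k)) \<bullet> res (Suc (Suc k)) = 1 / \<gamma> * (norm (p (Suc (Suc k)) - p (Suc k)))\<^sup>2"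
      by (simp add: power2_norm_eq_inner)
    then show ?thesis by (simp add: Lr_def res_def inner_diff_left)
  qed
  have h7: "(L\<^sub>G + norm (q (Suc k)) * L\<Omega> - step_denom (Suc k)) / 2 * a
      = - (\<gamma> * L\<Theta>\<^sup>2 * a) / 2 - 7 * (W * a) - 7 * (M * a) - a / 2"
    unfolding step_denom_def W_def M_def g_def by (simp add: algebra_simps diff_divide_distrib add_divide_distrib)
  have h8: "\<gamma> * L\<Theta>\<^sup>2 * a \<le> W * a"
  proof -
    have "\<gamma> * L\<Theta>\<^sup>2 * 1 \<le> \<gamma> * L\<Theta>\<^sup>2 * (b\<^sup>2 / lmin)"
      using lmin_le_b lmin_pos \<gamma> by (intro mult_left_mono) auto
    then show ?thesis using ac by (intro mult_right_mono) (auto simp: W_def field_simps)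
  qed
  have h9: "S * c \<le> s * c / 4"
  proof -
    have "s * (4 * s) \<le> s * g" using g consts_nonneg by (intro mult_left_mono) auto
    then have "S \<le> s / 4" using g by (simp add: S_def power2_eq_square field_simps)
    from mult_right_mono[OF this ac(2)] show ?thesis by simp
  qed
  have h10: "4 * (s * c) \<le> g * c" using mult_right_mono[OF g(2) ac(2)] by (simp add: distrib_right)
  have h1: "Lr (u (Suc (Suc k))) (v (Suc (Suc k))) (p (Suc k)) \<le> Lr (u (Suc k)) (v (Suc k)) (p (Suc k))
    + (L\<^sub>G + norm (q (Suc k)) * L\<Omega> - step_denom (Suc k)) / 2 * a + s * c / 2 - \<gamma> * Y\<^sup>2
    + \<gamma> / 2 * (norm (\<Theta> (u (Suc (Suc k))) - \<Theta> (u (Suc k)) + B *v (v (Suc (Suc k)) - v (Suc k))))\<^sup>2"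
    using primal_descent[of k] by (simp add: a_def c_def Y_def)
  have "Psi (Suc k) = Lr (u (Suc (Suc k))) (v (Suc (Suc k))) (p (Suc (Suc k))) + 3 * (M * a) + 3 * (S * c)"
    by (simp add: Psi_def M_def S_def a_def c_def g_def)
  moreover have "Psi k = Lr (u (Suc k)) (v (Suc k)) (p (Suc k)) + 3 * (M * (du k)\<^sup>2) + 3 * (S * (dv k)\<^sup>2)"
    by (simp add: Psi_def M_def S_def g_def)
  ultimately have "Psi (Suc k) \<le> Psi k - a / 2 - g * c / 8"
    using h1 h2 h3 h4 h5 h6 h7 h8 h9 h10 Ma by linarith
  then show ?thesis by (simp add: a_def c_def g_def)
qed

section \<open>Lower bound, boundedness and vanishing steps\<close>

lemma Psi_lower:
  assumes y: "\<Theta> (u (Suc k)) + B *v y = 0"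
  shows "G (u (Suc k), y) + Jr (u (Suc k)) + H y + \<gamma> * lmin / 8 * (norm (v (Suc k) - y))\<^sup>2 \<le> Psi k"
proof -
  define g where "g = \<gamma> * lmin"
  define x y0 where "x = u (Suc k)" and "y0 = v (Suc k)"
  define d where "d = y0 - y"
  \<comment> \<open>The \<open>v\<close>-gradient of the Lagrangian without penalty. By
    \<open>dual_eq\<close> it is of the order of the last primal steps, so the correction terms of
    \<open>Psi\<close> absorb its square.\<close>
  define e where "e = transpose B *v p (Suc k) + gradv x y0"
  have g: "0 < g" "4 * s \<le> g" using gamma_lmin_pos gamma_lmin by (auto simp: g_def)
  have r: "\<Theta> x + B *v y0 = B *v d"
    using y by (simp add: d_def x_def matrix_vector_mult_diff_distrib eq_neg_iff_add_eq_0[symmetric])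
  have "norm e \<le> m * du k + s * dv k"
  proof -
    have "e = (gradv x y0 - gradv (u k) (v k)) + \<gamma> *\<^sub>R (transpose B *v (\<Theta> x - \<Theta> (u k)))"
      by (simp add: e_def dual_eq x_def)
    then have "norm e \<le> norm (gradv x y0 - gradv (u k) (v k)) + norm (\<gamma> *\<^sub>R (transpose B *v (\<Theta> x - \<Theta> (u k))))"
      by (simp only: norm_triangle_ineq)
    also have "\<dots> \<le> (L\<^sub>G * du k + s * dv k) + \<gamma> * b * L\<Theta> * du k"
      unfolding x_def y0_def by (intro add_mono gradv_diff transpose_B_\<Theta>)
    finally show ?thesis by (simp add: algebra_simps)
  qed
  then have "(norm e)\<^sup>2 \<le> (m * du k + s * dv k)\<^sup>2" by (intro power_mono) auto
  also have "\<dots> \<le> 2 * ((m * du k)\<^sup>2 + (s * dv k)\<^sup>2)" by (rule sum2_squares_bound)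
  finally have e: "(norm e)\<^sup>2 / g \<le> 3 * (m\<^sup>2 / g) * (du k)\<^sup>2 + 3 * (s\<^sup>2 / g) * (dv k)\<^sup>2"
  proof -
    assume "(norm e)\<^sup>2 \<le> 2 * ((m * du k)\<^sup>2 + (s * dv k)\<^sup>2)"
    also have "\<dots> \<le> 3 * ((m * du k)\<^sup>2 + (s * dv k)\<^sup>2)" by (intro mult_right_mono) auto
    finally have "(norm e)\<^sup>2 / g \<le> 3 * ((m * du k)\<^sup>2 + (s * dv k)\<^sup>2) / g"
      using g by (intro divide_right_mono) auto
    then show ?thesis by (simp add: power_mult_distrib add_divide_distrib)
  qed
  have G: "G (x, y) \<le> G (x, y0) - grad_snd G x y0 \<bullet> d + L\<^sub>G / 2 * (norm d)\<^sup>2"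
    using lipschitz_grad_upper_bound[OF G_diff G_lip, of "(x, y)" "(x, y0)"]
    by (simp add: grad_Pair[OF G_diff] norm_Pair d_def inner_diff_right norm_minus_commute)
  have H: "H y \<le> H y0 - grad H y0 \<bullet> d + L\<^sub>H / 2 * (norm d)\<^sup>2"
    using lipschitz_grad_upper_bound[OF H_diff H_lip, of y y0]
    by (simp add: d_def inner_diff_right norm_minus_commute)
  have P: "p (Suc k) \<bullet> (B *v d) = e \<bullet> d - grad_snd G x y0 \<bullet> d - grad H y0 \<bullet> d"
    by (simp add: e_def gradv_def inner_add_left inner_transpose_mult)
  have ed: "- (e \<bullet> d) \<le> g / 4 * (norm d)\<^sup>2 + (norm e)\<^sup>2 / g"
  proof -
    have "- (e \<bullet> d) \<le> norm e * norm d" using Cauchy_Schwarz_ineq2[of e d] by linarith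
    moreover have "0 \<le> (g * norm d / 2 - norm e)\<^sup>2 / g" using g by simp
    moreover have "(g * norm d / 2 - norm e)\<^sup>2 / g = g / 4 * (norm d)\<^sup>2 + (norm e)\<^sup>2 / g - norm e * norm d"
      using g by (simp add: power2_eq_square field_simps)
    ultimately show ?thesis by linarith
  qed
  \<comment> \<open>Of the penalty curvature \<open>g / 2\<close>, a share \<open>g / 4\<close> goes
    to \<open>ed\<close> and at most \<open>g / 8\<close> to the quadratic errors of
    \<open>G\<close> and \<open>H\<close>; the remaining \<open>g / 8\<close> is the term in the
    claim.\<close>
  have Bd: "g / 2 * (norm d)\<^sup>2 \<le> \<gamma> / 2 * (norm (B *v d))\<^sup>2"
    using lmin_le[of d] \<gamma> by (simp add: g_def mult.assoc)
  have sd: "s * (norm d)\<^sup>2 \<le> g * (norm d)\<^sup>2 / 4"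
    using mult_right_mono[OF g(2), of "(norm d)\<^sup>2"] by (simp add: distrib_right)
  have sd': "s * (norm d)\<^sup>2 = L\<^sub>G * (norm d)\<^sup>2 + L\<^sub>H * (norm d)\<^sup>2" by (simp add: algebra_simps)
  have "Psi k = G (x, y0) + Jr x + H y0 + p (Suc k) \<bullet> (B *v d) + \<gamma> / 2 * (norm (B *v d))\<^sup>2
      + (3 * (m\<^sup>2 / g) * (du k)\<^sup>2 + 3 * (s\<^sup>2 / g) * (dv k)\<^sup>2)"
    by (simp add: Psi_def Lr_def g_def x_def[symmetric] y0_def[symmetric] r)
  then have "G (x, y) + Jr x + H y + g / 8 * (norm d)\<^sup>2 \<le> Psi k"
    using G H P ed Bd sd sd' e by linarith
  then show ?thesis by (simp add: x_def d_def y0_def g_def)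
qed

lemma feasible_ex: "\<exists>y. \<Theta> x + B *v y = 0"
proof -
  obtain z where "\<Theta> x = B *v z" using B_range by blast
  then have "\<Theta> x + B *v (- z) = B *v (z + - z)" by (simp only: matrix_vector_right_distrib)
  then show ?thesis by (intro exI[of _ "- z"]) simp
qed

lemma objective_u: "objective G J H (u (Suc k), y) = ereal (G (u (Suc k), y) + Jr (u (Suc k)) + H y)"
  by (simp add: objective_def J_u)

lemma decseq_Psi: "decseq Psi"
proof (rule decseq_SucI)
  fix k
  have "0 \<le> \<gamma> * lmin / 8 * (dv (Suc k))\<^sup>2" using gamma_lmin_pos by simp
  then show "Psi (Suc k) \<le> Psi k" using Psi_descent[of k] zero_le_power2[of "du (Suc k)"] by linarith
qed

lemma Psi_bounded_below: "\<exists>c. \<forall>k. c \<le> Psi k"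
proof -
  obtain c where c: "\<And>x y. \<Theta> x + B *v y = 0 \<Longrightarrow> ereal c \<le> objective G J H (x, y)"
    using F_bdd by auto
  have "c \<le> Psi k" for k
  proof -
    obtain y where y: "\<Theta> (u (Suc k)) + B *v y = 0" using feasible_ex by blast
    have "0 \<le> \<gamma> * lmin / 8 * (norm (v (Suc k) - y))\<^sup>2" using gamma_lmin_pos by simp
    then show ?thesis using c[OF y] Psi_lower[OF y] by (simp add: objective_u)
  qed
  then show ?thesis by blast
qed

lemma bounded_uv: "bounded (range u)" "bounded (range v)"
proof -
  obtain c where c: "\<And>x y. \<Theta> x + B *v y = 0 \<Longrightarrow> ereal c \<le> objective G J H (x, y)"
    using F_bdd by auto
  have "\<forall>\<^sub>F z in inf at_infinity (principal {(x, y). \<Theta> x + B *v y = 0}). ereal (Psi 0) < objective G J H z"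
    using F_coercive by (simp add: tendsto_PInfty)
  then obtain R where R: "\<And>x y. R \<le> norm (x, y) \<Longrightarrow> \<Theta> x + B *v y = 0 \<Longrightarrow> ereal (Psi 0) < objective G J H (x, y)"
    unfolding eventually_inf_principal eventually_at_infinity by blast
  \<comment> \<open>Coercivity bounds \<open>u\<close> and the feasible \<open>y\<close>, whose
    objective is at most \<open>Psi 0\<close>. The distance from \<open>v\<close> to
    \<open>y\<close> is bounded by the quadratic surplus, once the objective is replaced by its
    lower bound \<open>c\<close>.\<close>
  define C where "C = R + sqrt ((Psi 0 - c) * 8 / (\<gamma> * lmin))"
  have "norm (u (Suc k)) \<le> R \<and> norm (v (Suc k)) \<le> C" for k
  proof -
    obtain y where y: "\<Theta> (u (Suc k)) + B *v y = 0" using feasible_ex by blast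
    have low: "G (u (Suc k), y) + Jr (u (Suc k)) + H y + \<gamma> * lmin / 8 * (norm (v (Suc k) - y))\<^sup>2 \<le> Psi 0"
      using Psi_lower[OF y] decseqD[OF decseq_Psi, of 0 k] by linarith
    have nn: "0 \<le> \<gamma> * lmin / 8 * (norm (v (Suc k) - y))\<^sup>2" using gamma_lmin_pos by simp
    have "norm (u (Suc k), y) < R"
    proof (rule ccontr)
      assume "\<not> norm (u (Suc k), y) < R"
      then have "Psi 0 < G (u (Suc k), y) + Jr (u (Suc k)) + H y" using R[OF _ y] by (simp add: objective_u)
      with low nn show False by linarith
    qed
    then have Rn: "norm (u (Suc k)) \<le> R" "norm y \<le> R"
      using norm_fst_le[of "u (Suc k)" y] norm_snd_le[of y "u (Suc k)"] by linarith+
    have "c \<le> G (u (Suc k), y) + Jr (u (Suc k)) + H y" using c[OF y] by (simp add: objective_u)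
    then have "\<gamma> * lmin / 8 * (norm (v (Suc k) - y))\<^sup>2 \<le> Psi 0 - c" using low by linarith
    then have "(norm (v (Suc k) - y))\<^sup>2 \<le> (Psi 0 - c) * 8 / (\<gamma> * lmin)"
      using gamma_lmin_pos by (simp add: pos_le_divide_eq mult.commute)
    then have "norm (v (Suc k) - y) \<le> sqrt ((Psi 0 - c) * 8 / (\<gamma> * lmin))" by (rule real_le_rsqrt)
    then have "norm (v (Suc k)) \<le> C"
      using norm_triangle_ineq[of "v (Suc k) - y" y] Rn by (simp add: C_def)
    with Rn show ?thesis by simp
  qed
  then have "bounded (range (\<lambda>k. u (Suc k)))" "bounded (range (\<lambda>k. v (Suc k)))"
    by (auto simp: bounded_iff)
  then show "bounded (range u)" "bounded (range v)" by (auto intro: bounded_range_Suc)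
qed

lemma bounded_p: "bounded (range p)"
proof -
  obtain R where R: "\<And>k. norm (u k) \<le> R" "\<And>k. norm (v k) \<le> R"
  proof -
    obtain R1 R2 where "\<forall>k. norm (u k) \<le> R1" "\<forall>k. norm (v k) \<le> R2"
      using bounded_uv unfolding bounded_iff by auto
    then show ?thesis using that[of "max R1 R2"] by (simp add: le_max_iff_disj)
  qed
  have diff: "norm (x - y) \<le> 2 * R" if "norm x \<le> R" "norm y \<le> R" for x y :: "'z::real_normed_vector"
    using norm_triangle_ineq4[of x y] that by linarith
  define C where "C = norm (gradv 0 0) + (L\<^sub>G * R + s * R) + \<gamma> * b * L\<Theta> * (2 * R)"
  have C: "norm (transpose B *v p (Suc k)) \<le> C" for k
  proof -
    have "norm (gradv (u k) (v k)) \<le> norm (gradv 0 0) + norm (gradv (u k) (v k) - gradv 0 0)"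
      by (rule norm_triangle_sub)
    also have "norm (gradv (u k) (v k) - gradv 0 0) \<le> L\<^sub>G * norm (u k - 0) + s * norm (v k - 0)"
      by (rule gradv_diff)
    also have "\<dots> \<le> L\<^sub>G * R + s * R"
      using R consts_nonneg by (intro add_mono mult_left_mono) auto
    finally have 1: "norm (gradv (u k) (v k)) \<le> norm (gradv 0 0) + (L\<^sub>G * R + s * R)" by simp
    have "norm (\<gamma> *\<^sub>R (transpose B *v (\<Theta> (u (Suc k)) - \<Theta> (u k)))) \<le> \<gamma> * b * L\<Theta> * du k"
      by (rule transpose_B_\<Theta>)
    also have "\<dots> \<le> \<gamma> * b * L\<Theta> * (2 * R)"
      using R consts_nonneg \<gamma> by (intro mult_left_mono diff) auto
    finally have 2: "norm (\<gamma> *\<^sub>R (transpose B *v (\<Theta> (u (Suc k)) - \<Theta> (u k)))) \<le> \<gamma> * b * L\<Theta> * (2 * R)" .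
    show ?thesis
      unfolding dual_eq C_def
      using norm_triangle_ineq[of "- gradv (u k) (v k)" "\<gamma> *\<^sub>R (transpose B *v (\<Theta> (u (Suc k)) - \<Theta> (u k)))"] 1 2
      by (simp only: norm_minus_cancel)
  qed
  \<comment> \<open>The initial multiplier may have a component outside the range of
    \<open>B\<close>, so the lower bound for the transpose is applied to
    \<open>p k - p 0\<close>.\<close>
  have ran: "\<exists>y. p k - p 0 = B *v y" for k
  proof (induction k)
    case 0
    show ?case by (intro exI[of _ 0]) simp
  next
    case (Suc k)
    then obtain y where y: "p k - p 0 = B *v y" by blast
    obtain z where z: "p (Suc k) - p k = B *v z" using p_diff_range[of k] by blast
    have "p (Suc k) - p 0 = (p (Suc k) - p k) + (p k - p 0)" by simp
    also have "\<dots> = B *v (z + y)" by (simp only: y z matrix_vector_right_distrib)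
    finally show ?case by blast
  qed
  define C' where "C' = sqrt ((C + norm (transpose B *v p 0))\<^sup>2 / lmin)"
  have "norm (p (Suc k)) \<le> C' + norm (p 0)" for k
  proof -
    have "p (Suc k) - p 0 \<in> range ((*v) B)" using ran[of "Suc k"] by auto
    then have "lmin * (norm (p (Suc k) - p 0))\<^sup>2 \<le> (norm (transpose B *v (p (Suc k) - p 0)))\<^sup>2"
      by (rule lmin_le_transpose)
    also have "\<dots> \<le> (C + norm (transpose B *v p 0))\<^sup>2"
    proof (rule power_mono)
      show "norm (transpose B *v (p (Suc k) - p 0)) \<le> C + norm (transpose B *v p 0)"
        unfolding matrix_vector_mult_diff_distrib
        using norm_triangle_ineq4[of "transpose B *v p (Suc k)" "transpose B *v p 0"] C[of k] by linarith
    qed simp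
    finally have "(norm (p (Suc k) - p 0))\<^sup>2 \<le> (C + norm (transpose B *v p 0))\<^sup>2 / lmin"
      using lmin_pos by (simp add: pos_le_divide_eq mult.commute)
    then have "norm (p (Suc k) - p 0) \<le> C'" unfolding C'_def by (rule real_le_rsqrt)
    then show ?thesis using norm_triangle_sub[of "p (Suc k)" "p 0"] by linarith
  qed
  then have "bounded (range (\<lambda>k. p (Suc k)))" by (auto simp: bounded_iff)
  then show ?thesis by (rule bounded_range_Suc)
qed

lemma step_limits:
  "(\<lambda>k. du k) \<longlonglongrightarrow> 0" "(\<lambda>k. dv k) \<longlonglongrightarrow> 0" "(\<lambda>k. norm (p (Suc k) - p k)) \<longlonglongrightarrow> 0"
  "convergent Psi"
proof -
  obtain c where c: "\<forall>k. c \<le> Psi k" using Psi_bounded_below by blast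
  obtain l where l: "Psi \<longlonglongrightarrow> l" using decseq_convergent[OF decseq_Psi c] by blast
  then show "convergent Psi" by (rule convergentI)
  have "(\<lambda>k. Psi k - Psi (Suc k)) \<longlonglongrightarrow> l - l" by (intro tendsto_diff l LIMSEQ_Suc)
  then have lim: "(\<lambda>k. Psi k - Psi (Suc k)) \<longlonglongrightarrow> 0" by simp
  \<comment> \<open>The estimates concern squares and start one index late; this removes
    both.\<close>
  have sq: "f \<longlonglongrightarrow> 0" if "(\<lambda>k. (f (Suc k))\<^sup>2) \<longlonglongrightarrow> 0" for f :: "nat \<Rightarrow> real"
  proof -
    have "(\<lambda>k. sqrt ((f (Suc k))\<^sup>2)) \<longlonglongrightarrow> sqrt 0" using that by (rule tendsto_real_sqrt)
    then have "(\<lambda>k. f (Suc k)) \<longlonglongrightarrow> 0" by (simp add: tendsto_rabs_zero_iff)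
    then show ?thesis by (simp add: filterlim_sequentially_Suc)
  qed
  have nn: "0 \<le> \<gamma> * lmin / 8 * (dv (Suc k))\<^sup>2" for k using gamma_lmin_pos by simp
  have "(\<lambda>k. (du (Suc k))\<^sup>2) \<longlonglongrightarrow> 0"
  proof (rule Lim_null_comparison)
    show "(\<lambda>k. 2 * (Psi k - Psi (Suc k))) \<longlonglongrightarrow> 0" by (rule tendsto_mult_right_zero[OF lim])
    have "(du (Suc k))\<^sup>2 \<le> 2 * (Psi k - Psi (Suc k))" for k
    proof -
      have "1 / 2 * (du (Suc k))\<^sup>2 \<le> Psi k - Psi (Suc k)" using Psi_descent[of k] nn[of k] by linarith
      then show ?thesis by simp
    qed
    then show "\<forall>\<^sub>F k in sequentially. norm ((du (Suc k))\<^sup>2) \<le> 2 * (Psi k - Psi (Suc k))" by simp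
  qed
  then show du: "(\<lambda>k. du k) \<longlonglongrightarrow> 0" by (rule sq)
  have "(\<lambda>k. (dv (Suc k))\<^sup>2) \<longlonglongrightarrow> 0"
  proof (rule Lim_null_comparison)
    show "(\<lambda>k. 8 / (\<gamma> * lmin) * (Psi k - Psi (Suc k))) \<longlonglongrightarrow> 0" by (rule tendsto_mult_right_zero[OF lim])
    have "(dv (Suc k))\<^sup>2 \<le> 8 / (\<gamma> * lmin) * (Psi k - Psi (Suc k))" for k
    proof -
      have "\<gamma> * lmin / 8 * (dv (Suc k))\<^sup>2 \<le> Psi k - Psi (Suc k)"
        using Psi_descent[of k] zero_le_power2[of "du (Suc k)"] by linarith
      then show ?thesis using gamma_lmin_pos by (simp add: field_simps)
    qed
    then show "\<forall>\<^sub>F k in sequentially. norm ((dv (Suc k))\<^sup>2) \<le> 8 / (\<gamma> * lmin) * (Psi k - Psi (Suc k))" by simp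
  qed
  then show dv: "(\<lambda>k. dv k) \<longlonglongrightarrow> 0" by (rule sq)
  have "(\<lambda>k. (norm (p (Suc (Suc k)) - p (Suc k)))\<^sup>2) \<longlonglongrightarrow> 0"
  proof (rule Lim_null_comparison)
    have "(\<lambda>k. 3 * ((m * du k)\<^sup>2 + (s * dv k)\<^sup>2 + (\<gamma> * b * L\<Theta> * du (Suc k))\<^sup>2) / lmin)
        \<longlonglongrightarrow> 3 * ((m * 0)\<^sup>2 + (s * 0)\<^sup>2 + (\<gamma> * b * L\<Theta> * 0)\<^sup>2) / lmin"
      using lmin_pos by (intro tendsto_intros du dv LIMSEQ_Suc[OF du]) auto
    then show "(\<lambda>k. 3 * ((m * du k)\<^sup>2 + (s * dv k)\<^sup>2 + (\<gamma> * b * L\<Theta> * du (Suc k))\<^sup>2) / lmin) \<longlonglongrightarrow> 0"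
      by simp
    show "\<forall>\<^sub>F k in sequentially. norm ((norm (p (Suc (Suc k)) - p (Suc k)))\<^sup>2)
        \<le> 3 * ((m * du k)\<^sup>2 + (s * dv k)\<^sup>2 + (\<gamma> * b * L\<Theta> * du (Suc k))\<^sup>2) / lmin"
    proof (rule always_eventually, rule allI)
      fix k
      show "norm ((norm (p (Suc (Suc k)) - p (Suc k)))\<^sup>2)
        \<le> 3 * ((m * du k)\<^sup>2 + (s * dv k)\<^sup>2 + (\<gamma> * b * L\<Theta> * du (Suc k))\<^sup>2) / lmin"
        using dual_step_bound[of k] lmin_pos by (simp add: pos_le_divide_eq mult.commute)
    qed
  qed
  then show "(\<lambda>k. norm (p (Suc k) - p k)) \<longlonglongrightarrow> 0" by (rule sq)
qed

section \<open>First-order conditions at the iterates and the stationarity residual\<close>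

lemma usub_has_derivative:
  "(usub x0 y0 q0 t has_derivative
     (\<lambda>h. (grad_fst G x0 y0 + transpose (jacobian \<Omega> (at x0)) *v q0 + transpose (jacobian \<Phi> (at x)) *v q0
        + t *\<^sub>R (grad K x - grad K x0)) \<bullet> h)) (at x)"
proof -
  have \<Phi>: "(\<Phi> has_derivative (\<lambda>h. jacobian \<Phi> (at x) *v h)) (at x)"
    using \<Phi>_diff by (simp add: jacobian_works)
  have usub: "usub x0 y0 q0 t = (\<lambda>x. grad_fst G x0 y0 \<bullet> x + q0 \<bullet> (jacobian \<Omega> (at x0) *v x + \<Phi> x)
      + t * (K x - K x0 - grad K x0 \<bullet> (x - x0)))"
    by (simp add: fun_eq_iff usub_def bregman_def)
  have "(usub x0 y0 q0 t has_derivative (\<lambda>h. grad_fst G x0 y0 \<bullet> h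
      + q0 \<bullet> (jacobian \<Omega> (at x0) *v h + jacobian \<Phi> (at x) *v h)
      + t * (grad K x \<bullet> h - grad K x0 \<bullet> h))) (at x)"
    unfolding usub
    by (auto intro!: derivative_eq_intros \<Phi> has_derivative_grad[OF K_diff]
        bounded_linear.has_derivative[OF matrix_vector_mul_bounded_linear])
  also have "(\<lambda>h. grad_fst G x0 y0 \<bullet> h
      + q0 \<bullet> (jacobian \<Omega> (at x0) *v h + jacobian \<Phi> (at x) *v h)
      + t * (grad K x \<bullet> h - grad K x0 \<bullet> h))
    = (\<lambda>h. (grad_fst G x0 y0 + transpose (jacobian \<Omega> (at x0)) *v q0 + transpose (jacobian \<Phi> (at x)) *v q0
        + t *\<^sub>R (grad K x - grad K x0)) \<bullet> h)"
    by (rule ext) (simp add: inner_add_left inner_add_right inner_diff_left inner_transpose_mult)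
  finally show ?thesis .
qed

lemma usub_first_order:
  assumes x: "x \<in> U" "\<bar>J x\<bar> \<noteq> \<infinity>"
    and opt: "\<And>x'. x' \<in> U \<Longrightarrow> J x + ereal (usub x0 y0 q0 t x) \<le> J x' + ereal (usub x0 y0 q0 t x')"
  obtains \<xi> \<eta> where "\<xi> \<in> limiting_subdifferential J x" "\<eta> \<in> normal_cone U x"
    "grad_fst G x0 y0 + transpose (jacobian \<Omega> (at x0)) *v q0 + transpose (jacobian \<Phi> (at x)) *v q0
        + t *\<^sub>R (grad K x - grad K x0) + \<xi> + \<eta> = 0"
proof (rule constrained_first_order_condition[OF U x(1) _ x(2) usub_has_derivative opt])
  assume "U \<noteq> UNIV"
  moreover have "x \<in> edom J \<inter> U" using x by (auto simp: edom_def)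
  ultimately show "lipschitz_around J x" using J_lip by blast
qed (use that in blast)+

lemma jacobian_\<Theta>: "jacobian \<Theta> (at x) = jacobian \<Omega> (at x) + jacobian \<Phi> (at x)"
  unfolding \<Theta>_def by (rule jacobian_add[OF \<Omega>_diff \<Phi>_diff])

lemma transpose_jacobian_\<Theta>_le: "norm (transpose (jacobian \<Theta> (at x)) *v y) \<le> L\<Theta> * norm y"
proof (rule norm_transpose_mult_le)
  fix h
  have "\<Theta> differentiable (at x)" unfolding \<Theta>_def using \<Omega>_diff \<Phi>_diff by simp
  then show "norm (jacobian \<Theta> (at x) *v h) \<le> L\<Theta> * norm h"
    by (intro has_derivative_lipschitz_bound[OF \<Theta>_lip]) (simp add: jacobian_works)
qed

lemma transpose_jacobian_\<Omega>_diff: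
  "norm (transpose (jacobian \<Omega> (at x)) *v y - transpose (jacobian \<Omega> (at x')) *v y)
    \<le> L\<Omega> * norm (x - x') * norm y"
  unfolding transpose_diff_mult[symmetric] L\<Omega>
  by (rule norm_transpose_mult_le[OF jacobian_lipschitz[OF \<Omega>_diff \<Omega>_lip]])

lemma res_Suc: "res (Suc k) = (1 / \<gamma>) *\<^sub>R (p (Suc k) - p k)"
  using \<gamma> by (simp add: p_Suc)

lemma bounded_q: "bounded (range q)"
proof -
  obtain P where P: "\<And>k. norm (p k) \<le> P" using bounded_p unfolding bounded_iff by auto
  have "norm (q (Suc k)) \<le> 3 * P" for k
  proof -
    have q: "q (Suc k) = p (Suc k) + (p (Suc k) - p k)" by (simp add: q_eq p_Suc)
    have "norm (q (Suc k)) \<le> norm (p (Suc k)) + (norm (p (Suc k)) + norm (p k))"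
      unfolding q
      by (rule order_trans[OF norm_triangle_ineq add_left_mono[OF norm_triangle_ineq4]])
    then show ?thesis using P[of k] P[of "Suc k"] by linarith
  qed
  then have "bounded (range (\<lambda>k. q (Suc k)))" by (auto simp: bounded_iff)
  then show ?thesis by (rule bounded_range_Suc)
qed

text \<open>\<open>step_denom k\<close> depends on \<open>k\<close> only through
  \<open>norm (q k)\<close>, so bounded multipliers keep the step sizes away from 0.\<close>

lemma inverse_step_size_bounded: "\<exists>T\<ge>0. \<forall>k. 1 / \<epsilon> k \<le> T"
proof -
  obtain Q where Q: "\<And>k. norm (q k) \<le> Q" using bounded_q unfolding bounded_iff by auto
  define D where "D = L\<^sub>G + Q * L\<Omega> + \<gamma> * L\<Theta>\<^sup>2 + 14 * \<gamma> * b\<^sup>2 * L\<Theta>\<^sup>2 / lmin + 14 * m\<^sup>2 / (\<gamma> * lmin) + 1"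
  have "1 / \<epsilon> k \<le> D / (\<sigma> * \<beta>)" for k
  proof -
    have "step_denom k \<le> D" unfolding step_denom_def D_def
      using mult_right_mono[OF Q consts_nonneg(4), of k] by linarith
    then have "step_denom k / (\<sigma> * \<beta>) \<le> D / (\<sigma> * \<beta>)" using \<sigma> K_sc by (intro divide_right_mono) auto
    with step_size_bounds(3)[of k] show ?thesis by linarith
  qed
  moreover from this[of 0] have "0 \<le> D / (\<sigma> * \<beta>)"
    using step_size_bounds(1)[of 0] by (smt (verit) divide_nonneg_pos)
  ultimately show ?thesis by blast
qed

text \<open>The subgradient and the normal vector furnished by the \<open>u\<close>-subproblem also
  serve in the subdifferential at \<open>w (Suc k)\<close>. The resulting element consists of
  differences between data at steps \<open>k\<close> and \<open>Suc k\<close>, each Lipschitz in the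
  iterates.\<close>

lemma subdifferential_residual:
  "\<exists>c>0. \<forall>k. edist_set 0 (subdiff_aug_lagrangian U G J H \<Theta> B \<gamma> (u (Suc k), v (Suc k), p (Suc k)))
    \<le> ereal (c * norm ((u k, v k, p k) - (u (Suc k), v (Suc k), p (Suc k))))"
proof -
  obtain T where T: "T \<ge> 0" "\<And>k. 1 / \<epsilon> k \<le> T" using inverse_step_size_bounded by auto
  obtain Q where Q: "\<And>k. norm (q k) \<le> Q" using bounded_q unfolding bounded_iff by auto
  have Q0: "0 \<le> Q" using Q[of 0] norm_ge_zero order_trans by blast
  define A where "A = 1 + \<gamma> * (L\<Theta> + b)"
  define c where "c = (2 * L\<^sub>G + L\<Theta> * A + L\<Omega> * Q + T * L\<^sub>K) + (L\<^sub>G + s + b * A + \<gamma> * b * b) + 1 / \<gamma>"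
  have "c > 0" unfolding c_def A_def using consts_nonneg \<gamma> Q0 T
    by (intro add_nonneg_pos add_nonneg_nonneg mult_nonneg_nonneg) auto
  moreover have "edist_set 0 (subdiff_aug_lagrangian U G J H \<Theta> B \<gamma> (u (Suc k), v (Suc k), p (Suc k)))
    \<le> ereal (c * norm ((u k, v k, p k) - (u (Suc k), v (Suc k), p (Suc k))))" for k
  proof -
    define D where "D = norm ((u k, v k, p k) - (u (Suc k), v (Suc k), p (Suc k)))"
    define x y x' y' where "x = u k" and "y = v k" and "x' = u (Suc k)" and "y' = v (Suc k)"
    note defs = x_def y_def x'_def y'_def
    have D: "norm (x' - x) \<le> D" "norm (y' - y) \<le> D" "norm (p (Suc k) - p k) \<le> D"
    proof -
      have D': "D = norm (x - x', y - y', p k - p (Suc k))" by (simp add: D_def defs)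
      show "norm (x' - x) \<le> D" unfolding D' by (metis norm_fst_le norm_minus_commute)
      have le: "norm (y - y', p k - p (Suc k)) \<le> D" unfolding D' by (rule norm_snd_le)
      show "norm (y' - y) \<le> D" using le norm_fst_le[of "y - y'" "p k - p (Suc k)"]
        by (simp add: norm_minus_commute)
      show "norm (p (Suc k) - p k) \<le> D" using le norm_snd_le[of "p k - p (Suc k)" "y - y'"]
        by (simp add: norm_minus_commute)
    qed
    have D0: "0 \<le> D" by (simp add: D_def)
    obtain \<xi> \<eta> where \<xi>: "\<xi> \<in> limiting_subdifferential J x'" and \<eta>: "\<eta> \<in> normal_cone U x'"
      and eq: "grad_fst G x y + transpose (jacobian \<Omega> (at x)) *v q k + transpose (jacobian \<Phi> (at x')) *v q k
        + (1 / \<epsilon> k) *\<^sub>R (grad K x' - grad K x) + \<xi> + \<eta> = 0"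
      using usub_first_order[OF u_mem J_finite u_opt, of k] unfolding defs by blast
    define z1 where "z1 = grad_fst G x' y' + \<xi> + \<eta> + transpose (jacobian \<Theta> (at x')) *v q (Suc k)"
    define z2 where "z2 = gradv x' y' + transpose B *v q (Suc k)"
    define z3 where "z3 = res (Suc k)"
    have q': "p (Suc k) + \<gamma> *\<^sub>R (\<Theta> (u (Suc k)) + B *v v (Suc k)) = q (Suc k)" by (simp add: q_eq res_def)
    have mem: "(z1, z2, z3) \<in> subdiff_aug_lagrangian U G J H \<Theta> B \<gamma> (u (Suc k), v (Suc k), p (Suc k))"
      unfolding subdiff_aug_lagrangian_def prod.case q' z1_def z2_def z3_def
      using \<xi> \<eta> by (auto simp: defs gradv_def res_def)
    have dq: "norm (q (Suc k) - q k) \<le> A * D"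
    proof -
      have "q (Suc k) - q k = (p (Suc k) - p k) + \<gamma> *\<^sub>R ((\<Theta> x' - \<Theta> x) + B *v (y' - y))"
        by (simp add: q_eq res_def defs matrix_vector_mult_diff_distrib algebra_simps)
      then have "norm (q (Suc k) - q k) \<le> norm (p (Suc k) - p k) + \<gamma> * norm ((\<Theta> x' - \<Theta> x) + B *v (y' - y))"
        using \<gamma> norm_triangle_ineq[of "p (Suc k) - p k" "\<gamma> *\<^sub>R ((\<Theta> x' - \<Theta> x) + B *v (y' - y))"] by simp
      also have "\<dots> \<le> D + \<gamma> * (L\<Theta> * D + b * D)"
      proof -
        have "norm ((\<Theta> x' - \<Theta> x) + B *v (y' - y)) \<le> norm (\<Theta> x' - \<Theta> x) + norm (B *v (y' - y))"
          by (rule norm_triangle_ineq)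
        also have "\<dots> \<le> L\<Theta> * norm (x' - x) + b * norm (y' - y)" by (intro add_mono \<Theta>_bound norm_B_le)
        also have "\<dots> \<le> L\<Theta> * D + b * D" using D consts_nonneg by (intro add_mono mult_left_mono) auto
        finally show ?thesis using D \<gamma> by (intro add_mono mult_left_mono) auto
      qed
      also have "\<dots> = A * D" by (simp add: A_def algebra_simps)
      finally show ?thesis .
    qed
    have "norm z1 \<le> (2 * L\<^sub>G + L\<Theta> * A + L\<Omega> * Q + T * L\<^sub>K) * D"
    proof -
      let ?a = "grad_fst G x' y' - grad_fst G x y"
      let ?b = "transpose (jacobian \<Theta> (at x')) *v (q (Suc k) - q k)"
      let ?c = "transpose (jacobian \<Omega> (at x')) *v q k - transpose (jacobian \<Omega> (at x)) *v q k"
      let ?d = "(1 / \<epsilon> k) *\<^sub>R (grad K x' - grad K x)"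
      have xe: "\<xi> + \<eta> = - (grad_fst G x y + transpose (jacobian \<Omega> (at x)) *v q k
          + transpose (jacobian \<Phi> (at x')) *v q k + ?d)"
        using eq by (simp only: add.assoc[of _ \<xi> \<eta>] add_eq_0_iff)
      have ze: "z1 = grad_fst G x' y' + (\<xi> + \<eta>) + transpose (jacobian \<Theta> (at x')) *v q (Suc k)"
        by (simp add: z1_def add.assoc)
      have te: "transpose (jacobian \<Theta> (at x')) *v q (Suc k) = ?b + transpose (jacobian \<Omega> (at x')) *v q k
          + transpose (jacobian \<Phi> (at x')) *v q k"
        by (simp add: matrix_vector_mult_diff_distrib) (simp add: jacobian_\<Theta> transpose_add_mult)
      \<comment> \<open>Both conditions contain the Jacobian of \<Phi> at the same point
        \<open>x'\<close>, so it cancels; only the Jacobian of \<Omega> is compared at two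
        points.\<close>
      have "z1 = ?a + ?b + ?c - ?d" unfolding ze xe te by (simp add: algebra_simps)
      then have "norm z1 \<le> norm ?a + norm ?b + norm ?c + norm ?d"
        by (simp only: norm_add3_diff)
      also have "norm ?a \<le> 2 * L\<^sub>G * D"
      proof -
        have "norm ?a \<le> L\<^sub>G * (norm (x' - x) + norm (y' - y))" by (rule grad_fst_diff)
        also have "\<dots> \<le> L\<^sub>G * (D + D)" using D consts_nonneg by (intro mult_left_mono add_mono) auto
        finally show ?thesis by simp
      qed
      also have "norm ?b \<le> L\<Theta> * A * D"
        using order_trans[OF transpose_jacobian_\<Theta>_le mult_left_mono[OF dq consts_nonneg(3)]]
        by (simp add: mult.assoc)
      also have "norm ?c \<le> L\<Omega> * Q * D"
      proof -
        have "norm ?c \<le> L\<Omega> * norm (x' - x) * norm (q k)" by (rule transpose_jacobian_\<Omega>_diff)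
        also have "\<dots> \<le> L\<Omega> * D * Q" using D Q consts_nonneg D0 by (intro mult_mono mult_left_mono) auto
        finally show ?thesis by (simp add: ac_simps)
      qed
      also have "norm ?d \<le> T * L\<^sub>K * D"
      proof -
        have "norm (grad K x' - grad K x) \<le> L\<^sub>K * norm (x' - x)"
          using lipschitz_onD[OF K_lip, of x' x] by (simp add: dist_norm)
        also have "\<dots> \<le> L\<^sub>K * D" using D consts_nonneg by (intro mult_left_mono) auto
        finally have "1 / \<epsilon> k * norm (grad K x' - grad K x) \<le> T * (L\<^sub>K * D)"
          using T step_size_bounds(1)[of k] by (intro mult_mono) auto
        then show ?thesis using step_size_bounds(1)[of k] by (simp add: mult.assoc)
      qed
      finally show ?thesis by (simp only: distrib_right)
    qed
    moreover have "norm z2 \<le> (L\<^sub>G + s + b * A + \<gamma> * b * b) * D"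
    proof -
      let ?a = "gradv x' y' - gradv x y"
      let ?b = "transpose B *v (q (Suc k) - q k)"
      let ?c = "\<gamma> *\<^sub>R (transpose B *v (B *v (y' - y)))"
      have "gradv x y = - (transpose B *v q k + ?c)"
        using v_opt[of k] unfolding defs eq_neg_iff_add_eq_0
        by (simp only: matrix_vector_right_distrib matrix_vector_mult_scaleR)
      then have "z2 = ?a + ?b - ?c" by (simp add: z2_def matrix_vector_mult_diff_distrib)
      then have "norm z2 \<le> norm ?a + norm ?b + norm ?c"
        by (simp only: norm_add2_diff)
      also have "norm ?a \<le> (L\<^sub>G + s) * D"
      proof -
        have "norm ?a \<le> L\<^sub>G * norm (x' - x) + s * norm (y' - y)" by (rule gradv_diff)
        also have "\<dots> \<le> L\<^sub>G * D + s * D" using D consts_nonneg by (intro add_mono mult_left_mono) auto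
        finally show ?thesis by (simp only: distrib_right)
      qed
      also have "norm ?b \<le> b * A * D"
        using order_trans[OF norm_B_le(2) mult_left_mono[OF dq consts_nonneg(6)]] by (simp add: mult.assoc)
      also have "norm ?c \<le> \<gamma> * b * b * D"
      proof -
        have "norm (B *v (y' - y)) \<le> b * D"
          using order_trans[OF norm_B_le(1) mult_left_mono[OF D(2) consts_nonneg(6)]] .
        then have "norm (transpose B *v (B *v (y' - y))) \<le> b * (b * D)"
          using order_trans[OF norm_B_le(2) mult_left_mono] consts_nonneg(6) by blast
        then show ?thesis using \<gamma> by (simp add: mult.assoc)
      qed
      finally show ?thesis by (simp only: distrib_right)
    qed
    moreover have "norm z3 \<le> 1 / \<gamma> * D"
      using D(3) \<gamma> by (simp add: z3_def res_Suc divide_right_mono)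
    moreover have "norm (z1, z2, z3) \<le> norm z1 + (norm z2 + norm z3)"
      using norm_Pair_le[of z1 "(z2, z3)"] norm_Pair_le[of z2 z3] by linarith
    ultimately have "norm (z1, z2, z3) \<le> c * D" by (simp add: c_def distrib_right)
    then have "ereal (norm (0 - (z1, z2, z3))) \<le> ereal (c * D)"
      by (simp only: diff_0 norm_minus_cancel ereal_less_eq)
    then show ?thesis unfolding edist_set_def D_def[symmetric] by (rule INF_lower2[OF mem])
  qed
  ultimately show ?thesis by blast
qed

section \<open>Limits of function values and cluster points\<close>

lemma res_limit: "res \<longlonglongrightarrow> 0"
proof -
  have "(\<lambda>k. p (Suc k) - p k) \<longlonglongrightarrow> 0" using step_limits(3) by (rule tendsto_norm_zero_cancel)
  then have "(\<lambda>k. (1 / \<gamma>) *\<^sub>R (p (Suc k) - p k)) \<longlonglongrightarrow> (1 / \<gamma>) *\<^sub>R 0" by (intro tendsto_intros)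
  then have "(\<lambda>k. res (Suc k)) \<longlonglongrightarrow> 0" by (simp add: res_Suc)
  then show ?thesis by (simp add: filterlim_sequentially_Suc)
qed

lemma continuous_G: "continuous_on UNIV G" and continuous_H: "continuous_on UNIV H"
  and continuous_K: "continuous_on UNIV K" and continuous_\<Phi>: "continuous_on UNIV \<Phi>"
  and continuous_\<Theta>: "continuous_on UNIV \<Theta>"
  by (simp_all add: differentiable_imp_continuous_on differentiable_on_def G_diff H_diff K_diff \<Phi>_diff
      lipschitz_on_continuous_on[OF \<Theta>_lip])

text \<open>\<Phi> enters only through its values, and the Jacobian of \<Omega> is continuous
  through its component gradients, so the subproblem objective is continuous in all data.\<close>

lemma tendsto_usub:
  assumes X: "X \<longlonglongrightarrow> x" and Y: "Y \<longlonglongrightarrow> y" and Q: "Q \<longlonglongrightarrow> q0" and Z: "Z \<longlonglongrightarrow> z"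
  shows "(\<lambda>n. usub (X n) (Y n) (Q n) t (Z n)) \<longlonglongrightarrow> usub x y q0 t z"
proof -
  have "(\<lambda>n. grad G (X n, Y n)) \<longlonglongrightarrow> grad G (x, y)"
    by (rule tendsto_UNIV[OF lipschitz_on_continuous_on[OF G_lip] tendsto_Pair[OF X Y]])
  from tendsto_fst[OF this] have 1: "(\<lambda>n. grad_fst G (X n) (Y n)) \<longlonglongrightarrow> grad_fst G x y"
    by (simp add: grad_Pair[OF G_diff])
  have 2: "(\<lambda>n. jacobian \<Omega> (at (X n)) *v Z n) \<longlonglongrightarrow> jacobian \<Omega> (at x) *v z"
  proof (rule vec_tendstoI)
    fix j
    show "(\<lambda>n. (jacobian \<Omega> (at (X n)) *v Z n) $ j) \<longlonglongrightarrow> (jacobian \<Omega> (at x) *v z) $ j"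
      unfolding jacobian_component[OF \<Omega>_diff]
      by (rule tendsto_inner[OF tendsto_UNIV[OF lipschitz_on_continuous_on[OF \<Omega>_lip] X] Z])
  qed
  note 3 = tendsto_UNIV[OF continuous_\<Phi> Z] tendsto_UNIV[OF continuous_K Z] tendsto_UNIV[OF continuous_K X]
    tendsto_UNIV[OF lipschitz_on_continuous_on[OF K_lip] X]
  show ?thesis
    unfolding usub_def bregman_def
    by (intro tendsto_add tendsto_diff tendsto_inner tendsto_mult tendsto_const 1 2 3 Q X Z)
qed

text \<open>Since steps vanish, the old and the new iterates along \<open>r\<close> have the same
  limit. Minimality then passes to the limit: \<open>x\<close> minimizes \<open>J\<close> plus
  \<open>usub x y z T\<close> over \<open>U\<close>. In the first-order condition of that problem
  the proximal term is \<open>T\<close> times the difference of equal gradients.\<close>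

lemma cluster_point_stationary:
  assumes r: "strict_mono r" and lim: "(\<lambda>n. u (Suc (r n))) \<longlonglongrightarrow> x" "(\<lambda>n. v (Suc (r n))) \<longlonglongrightarrow> y"
    "(\<lambda>n. p (Suc (r n))) \<longlonglongrightarrow> z"
  shows "stationary_point U G J H \<Theta> B \<gamma> (x, y, z)" "\<bar>J x\<bar> \<noteq> \<infinity>" "\<Theta> x + B *v y = 0"
    "(\<lambda>n. Jr (u (Suc (r n)))) \<longlonglongrightarrow> Jr x"
proof -
  have shift: "(\<lambda>n. f (r n)) \<longlonglongrightarrow> l"
    if "(\<lambda>n. f (Suc (r n))) \<longlonglongrightarrow> l" "(\<lambda>k. norm (f (Suc k) - f k)) \<longlonglongrightarrow> 0"
    for f :: "nat \<Rightarrow> 'z::real_normed_vector" and l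
  proof -
    have "(\<lambda>k. f (Suc k) - f k) \<longlonglongrightarrow> 0" using that(2) by (rule tendsto_norm_zero_cancel)
    from LIMSEQ_subseq_LIMSEQ[OF this r]
    have "(\<lambda>n. f (Suc (r n)) - f (r n)) \<longlonglongrightarrow> 0" by (simp add: o_def)
    from tendsto_diff[OF that(1) this] show ?thesis by simp
  qed
  have u: "(\<lambda>n. u (r n)) \<longlonglongrightarrow> x" by (rule shift[OF lim(1) step_limits(1)])
  have v: "(\<lambda>n. v (r n)) \<longlonglongrightarrow> y" by (rule shift[OF lim(2) step_limits(2)])
  have p: "(\<lambda>n. p (r n)) \<longlonglongrightarrow> z" by (rule shift[OF lim(3) step_limits(3)])
  have res: "(\<lambda>n. res (r n)) \<longlonglongrightarrow> 0" using LIMSEQ_subseq_LIMSEQ[OF res_limit r] by (simp add: o_def)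
  have q: "(\<lambda>n. q (r n)) \<longlonglongrightarrow> z"
    using tendsto_add[OF p tendsto_scaleR[OF tendsto_const[of \<gamma>] res]] by (simp add: q_eq)
  have mat: "(\<lambda>n. A *v f n) \<longlonglongrightarrow> A *v l" if "f \<longlonglongrightarrow> l" for A :: "real^'i^'j" and f l
    by (rule tendsto_UNIV[OF matrix_vector_mult_linear_continuous_on that])
  show feas: "\<Theta> x + B *v y = 0"
  proof (rule LIMSEQ_unique[OF _ res])
    show "(\<lambda>n. res (r n)) \<longlonglongrightarrow> \<Theta> x + B *v y"
      unfolding res_def by (intro tendsto_add tendsto_UNIV[OF continuous_\<Theta> u] mat v)
  qed
  have gv: "gradv x y + transpose B *v z = 0"
  proof (rule LIMSEQ_unique[OF _ tendsto_const])
    have "(\<lambda>n. grad G (u (r n), v (r n))) \<longlonglongrightarrow> grad G (x, y)"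
      by (rule tendsto_UNIV[OF lipschitz_on_continuous_on[OF G_lip] tendsto_Pair[OF u v]])
    from tendsto_snd[OF this] have "(\<lambda>n. grad_snd G (u (r n)) (v (r n))) \<longlonglongrightarrow> grad_snd G x y"
      by (simp add: grad_Pair[OF G_diff])
    then have "(\<lambda>n. gradv (u (r n)) (v (r n))) \<longlonglongrightarrow> gradv x y"
      unfolding gradv_def
      by (intro tendsto_add tendsto_UNIV[OF lipschitz_on_continuous_on[OF H_lip] v])
    then have "(\<lambda>n. gradv (u (r n)) (v (r n))
        + transpose B *v (q (r n) + \<gamma> *\<^sub>R (B *v (v (Suc (r n)) - v (r n)))))
      \<longlonglongrightarrow> gradv x y + transpose B *v (z + \<gamma> *\<^sub>R (B *v (y - y)))"
      by (intro tendsto_intros mat q lim v)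
    then show "(\<lambda>n. 0) \<longlonglongrightarrow> gradv x y + transpose B *v z" by (simp add: v_opt)
  qed
  have x: "x \<in> U" using U(1) u_mem lim(1) by (rule closed_sequentially)
  obtain T where T: "T \<ge> 0" "\<And>k. 1 / \<epsilon> k \<le> T" using inverse_step_size_bounded by auto
  \<comment> \<open>The weight is raised to \<open>T\<close> on the competitor and lowered to 0 on
    the minimizer. Both changes preserve the inequality because Bregman distances are
    nonnegative.\<close>
  define E where "E x' n = usub (u (r n)) (v (r n)) (q (r n)) T x' - usub (u (r n)) (v (r n)) (q (r n)) 0 (u (Suc (r n)))"
    for x' n
  have E: "E x' \<longlonglongrightarrow> usub x y z T x' - usub x y z T x" for x'
  proof -
    have "E x' \<longlonglongrightarrow> usub x y z T x' - usub x y z 0 x"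
      unfolding E_def by (intro tendsto_diff tendsto_usub u v q lim tendsto_const)
    \<comment> \<open>The weights 0 and \<open>T\<close> agree at \<open>x\<close>, as the Bregman
      distance of \<open>x\<close> to itself is 0.\<close>
    then show ?thesis by (simp add: usub_def bregman_def)
  qed
  have step: "Jr (u (Suc (r n))) \<le> a + E x' n" if x': "x' \<in> U" and a: "J x' = ereal a" for x' a n
  proof -
    define k where "k = r n"
    have nonneg: "0 \<le> bregman K x' x''" for x' x''
    proof -
      have "0 \<le> \<beta> / 2 * (norm (x' - x''))\<^sup>2" using K_sc by simp
      then show ?thesis using bregman_lower_bound[OF K_diff K_sc(2)] by (rule order_trans)
    qed
    have "1 / \<epsilon> k * bregman K x' (u k) \<le> T * bregman K x' (u k)"
      using T nonneg by (intro mult_right_mono)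
    moreover have "0 \<le> 1 / \<epsilon> k * bregman K (u (Suc k)) (u k)"
      using nonneg step_size_bounds(1)[of k] by simp
    moreover have "Jr (u (Suc k)) + usub (u k) (v k) (q k) (1 / \<epsilon> k) (u (Suc k)) \<le> a + usub (u k) (v k) (q k) (1 / \<epsilon> k) x'"
      using u_opt[OF x', of k] by (simp add: a J_u)
    ultimately show ?thesis by (simp add: E_def usub_def k_def[symmetric])
  qed
  have lsc: "\<forall>\<^sub>F n in sequentially. c < Jr (u (Suc (r n)))" if "ereal c < J x" for c
    using lower_semicontinuousD[OF J_lsc lim(1) that] by (simp add: J_u)
  have le: "J x \<le> ereal (a + (usub x y z T x' - usub x y z T x))" if x': "x' \<in> U" and a: "J x' = ereal a" for x' a
  proof (rule ccontr)
    assume "\<not> ?thesis"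
    then obtain c where c: "a + (usub x y z T x' - usub x y z T x) < c" "ereal c < J x"
      using ereal_dense2 by (metis less_ereal.simps(1) not_le)
    have "(\<lambda>n. a + E x' n) \<longlonglongrightarrow> a + (usub x y z T x' - usub x y z T x)"
      by (intro tendsto_add tendsto_const E)
    then have "\<forall>\<^sub>F n in sequentially. a + E x' n < c" using c(1) by (rule order_tendstoD)
    with lsc[OF c(2)] have "\<forall>\<^sub>F n in sequentially. False"
    proof eventually_elim
      case (elim n)
      with step[OF x' a, of n] show False by linarith
    qed
    then show False by simp
  qed
  have "J x \<noteq> -\<infinity>" using J_proper by (simp add: proper_ereal_def)
  \<comment> \<open>Any competitor in \<open>U\<close> with finite \<open>J\<close> will do; the
    first computed iterate is one.\<close>
  moreover have "J x \<noteq> \<infinity>" using le[OF u_mem J_u, of 0] by auto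
  ultimately show fin: "\<bar>J x\<bar> \<noteq> \<infinity>" by auto
  then have Jx: "J x = ereal (Jr x)" by (simp add: Jr_def ereal_real)
  show "(\<lambda>n. Jr (u (Suc (r n)))) \<longlonglongrightarrow> Jr x"
  proof (rule order_tendstoI)
    fix c assume "c < Jr x"
    then show "\<forall>\<^sub>F n in sequentially. c < Jr (u (Suc (r n)))" by (intro lsc) (simp add: Jx)
  next
    \<comment> \<open>Here the limit \<open>x\<close> itself is the competitor; it bounds the values
      of \<open>J\<close> from above, complementing lower semicontinuity.\<close>
    fix c assume c: "Jr x < c"
    have "(\<lambda>n. Jr x + E x n) \<longlonglongrightarrow> Jr x + (usub x y z T x - usub x y z T x)"
      by (intro tendsto_add tendsto_const E)
    then have "\<forall>\<^sub>F n in sequentially. Jr x + E x n < c" using c by (intro order_tendstoD(2)) auto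
    then show "\<forall>\<^sub>F n in sequentially. Jr (u (Suc (r n))) < c"
      using step[OF x Jx] by (auto elim!: eventually_mono intro: le_less_trans)
  qed
  have opt: "J x + ereal (usub x y z T x) \<le> J x' + ereal (usub x y z T x')" if x': "x' \<in> U" for x'
  proof (cases "J x'")
    case (real a)
    then show ?thesis using le[OF x' real] by (simp add: Jx)
  next
    case MInf
    then show ?thesis using J_proper by (simp add: proper_ereal_def)
  qed simp
  obtain \<xi> \<eta> where \<xi>\<eta>: "\<xi> \<in> limiting_subdifferential J x" "\<eta> \<in> normal_cone U x"
    and eq: "grad_fst G x y + transpose (jacobian \<Omega> (at x)) *v z + transpose (jacobian \<Phi> (at x)) *v z
        + T *\<^sub>R (grad K x - grad K x) + \<xi> + \<eta> = 0"
    using usub_first_order[OF x fin opt] by blast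
  have "grad_fst G x y + \<xi> + \<eta> + transpose (jacobian \<Theta> (at x)) *v (z + \<gamma> *\<^sub>R (\<Theta> x + B *v y)) = 0"
    using eq unfolding feas jacobian_\<Theta> transpose_add_mult by (simp add: algebra_simps)
  moreover have "grad_snd G x y + grad H y + transpose B *v (z + \<gamma> *\<^sub>R (\<Theta> x + B *v y)) = 0"
    using gv unfolding feas gradv_def by simp
  ultimately have "(0, 0, 0) \<in> subdiff_aug_lagrangian U G J H \<Theta> B \<gamma> (x, y, z)"
    unfolding subdiff_aug_lagrangian_def prod.case mem_Times_iff fst_conv snd_conv
    using \<xi>\<eta> feas by fastforce
  then show "stationary_point U G J H \<Theta> B \<gamma> (x, y, z)"
    using x by (simp add: stationary_point_def zero_prod_def)
qed

lemma aug_lagrangian_eq: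
  assumes "\<bar>J x\<bar> \<noteq> \<infinity>"
  shows "aug_lagrangian G J H \<Theta> B \<gamma> (x, y, z) = ereal (Lr x y z)"
proof -
  have "J x = ereal (Jr x)" using assms by (simp add: Jr_def ereal_real)
  then show ?thesis by (simp add: aug_lagrangian_def objective_def Lr_def)
qed

lemma Lr_limit:
  assumes "Psi \<longlonglongrightarrow> l"
  shows "(\<lambda>k. Lr (u (Suc k)) (v (Suc k)) (p (Suc k))) \<longlonglongrightarrow> l"
proof -
  have "(\<lambda>k. Psi k - 3 * (m\<^sup>2 / (\<gamma> * lmin)) * (du k)\<^sup>2 - 3 * (s\<^sup>2 / (\<gamma> * lmin)) * (dv k)\<^sup>2)
      \<longlonglongrightarrow> l - 3 * (m\<^sup>2 / (\<gamma> * lmin)) * 0\<^sup>2 - 3 * (s\<^sup>2 / (\<gamma> * lmin)) * 0\<^sup>2"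
    by (intro tendsto_diff tendsto_mult tendsto_power tendsto_const assms step_limits)
  then show ?thesis by (simp add: Psi_def)
qed

lemma objective_limit:
  assumes "Psi \<longlonglongrightarrow> l"
  shows "(\<lambda>k. objective G J H (u k, v k)) \<longlonglongrightarrow> ereal l"
proof -
  obtain P where P: "\<And>k. norm (p k) \<le> P" using bounded_p unfolding bounded_iff by auto
  have "(\<lambda>k. p (Suc k) \<bullet> res (Suc k)) \<longlonglongrightarrow> 0"
  proof (rule Lim_null_comparison)
    show "(\<lambda>k. P * norm (res (Suc k))) \<longlonglongrightarrow> 0"
      by (rule tendsto_mult_right_zero[OF tendsto_norm_zero[OF LIMSEQ_Suc[OF res_limit]]])
    show "\<forall>\<^sub>F k in sequentially. norm (p (Suc k) \<bullet> res (Suc k)) \<le> P * norm (res (Suc k))"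
      using order_trans[OF Cauchy_Schwarz_ineq2 mult_right_mono[OF P norm_ge_zero]] by simp
  qed
  then have "(\<lambda>k. Lr (u (Suc k)) (v (Suc k)) (p (Suc k)) - p (Suc k) \<bullet> res (Suc k)
      - \<gamma> / 2 * (norm (res (Suc k)))\<^sup>2) \<longlonglongrightarrow> l - 0 - \<gamma> / 2 * (norm (0 :: real^'m))\<^sup>2"
    by (intro tendsto_intros Lr_limit[OF assms] LIMSEQ_Suc[OF res_limit])
  then have "(\<lambda>k. G (u (Suc k), v (Suc k)) + Jr (u (Suc k)) + H (v (Suc k))) \<longlonglongrightarrow> l"
    by (simp add: Lr_def res_def add.assoc)
  then have "(\<lambda>k. objective G J H (u (Suc k), v (Suc k))) \<longlonglongrightarrow> ereal l"
    by (simp add: objective_u)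
  then show ?thesis by (rule LIMSEQ_imp_Suc)
qed

text \<open>Lower semicontinuity alone would give one inequality; equality rests on the convergence
  of the \<open>J\<close>-values along the subsequence.\<close>

lemma cluster_point_value:
  assumes "Psi \<longlonglongrightarrow> l"
    and r: "strict_mono r" and lim: "(\<lambda>n. u (Suc (r n))) \<longlonglongrightarrow> x" "(\<lambda>n. v (Suc (r n))) \<longlonglongrightarrow> y"
    "(\<lambda>n. p (Suc (r n))) \<longlonglongrightarrow> z"
  shows "aug_lagrangian G J H \<Theta> B \<gamma> (x, y, z) = ereal l"
proof -
  note * = cluster_point_stationary[OF r lim]
  have "(\<lambda>n. Lr (u (Suc (r n))) (v (Suc (r n))) (p (Suc (r n)))) \<longlonglongrightarrow> Lr x y z"
    unfolding Lr_def
    by (intro tendsto_intros *(4) lim tendsto_UNIV[OF continuous_G] tendsto_UNIV[OF continuous_H]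
        tendsto_UNIV[OF continuous_\<Theta>] tendsto_UNIV[OF matrix_vector_mult_linear_continuous_on])
  moreover have "(\<lambda>n. Lr (u (Suc (r n))) (v (Suc (r n))) (p (Suc (r n)))) \<longlonglongrightarrow> l"
    using LIMSEQ_subseq_LIMSEQ[OF Lr_limit[OF assms(1)] r] by (simp add: o_def)
  ultimately have "Lr x y z = l" by (rule LIMSEQ_unique)
  then show ?thesis using *(2) by (simp add: aug_lagrangian_eq)
qed

end

section \<open>Convergence\<close>

theorem theorem4p1:
  fixes U :: "(real^'n) set"
    and G :: "(real^'n) \<times> (real^'d) \<Rightarrow> real"
    and J :: "real^'n \<Rightarrow> ereal"
    and H :: "real^'d \<Rightarrow> real"
    and \<Omega> \<Phi> \<Theta> :: "real^'n \<Rightarrow> real^'m"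
    and B :: "real^'d^'m"
    and K :: "real^'n \<Rightarrow> real"
    and L\<^sub>G L\<^sub>H L\<Theta> L\<Omega> L\<^sub>K \<beta> \<gamma> \<sigma> lmin c\<^sub>1 c\<^sub>2 :: real
    and L\<Omega>c :: "'m \<Rightarrow> real"
    and \<delta> \<epsilon> :: "nat \<Rightarrow> real"
    and u :: "nat \<Rightarrow> real^'n" and v :: "nat \<Rightarrow> real^'d" and p q :: "nat \<Rightarrow> real^'m"
    and w :: "nat \<Rightarrow> (real^'n) \<times> (real^'d) \<times> (real^'m)"
    and \<Lambda> :: "nat \<Rightarrow> ereal"
  assumes U: "U \<noteq> {}" "closed U" "convex U"
    and \<Theta>_def: "\<Theta> = (\<lambda>x. \<Omega> x + \<Phi> x)"
    and \<Omega>_diff: "\<And>x. \<Omega> differentiable (at x)"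
    and \<Phi>_diff: "\<And>x. \<Phi> differentiable (at x)"
    and H1: "\<And>z. G differentiable (at z)" "L\<^sub>G-lipschitz_on UNIV (grad G)"
    and H2: "\<And>y. H differentiable (at y)" "L\<^sub>H-lipschitz_on UNIV (grad H)"
    and H3: "proper_ereal J" "lower_semicontinuous J"
            "U = UNIV \<Longrightarrow> convex (edom J)"
            "U \<noteq> UNIV \<Longrightarrow> \<forall>x\<in>edom J \<inter> U. lipschitz_around J x"
    and H4: "L\<Theta>-lipschitz_on UNIV \<Theta>"
    and H5: "\<And>j. (L\<Omega>c j)-lipschitz_on UNIV (grad (\<lambda>x. \<Omega> x $ j))"
            "L\<Omega> = (\<Sum>j\<in>UNIV. L\<Omega>c j)"
    and H6: "CARD('d) \<le> CARD('m)" "rank B = CARD('d)" "range \<Theta> \<subseteq> range ((*v) B)"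
    and H7: "\<exists>c::real. \<forall>(x, y)\<in>{(x, y). \<Theta> x + B *v y = 0}. ereal c \<le> objective G J H (x, y)"
            "(objective G J H \<longlongrightarrow> \<infinity>)
               (inf at_infinity (principal {(x, y). \<Theta> x + B *v y = 0}))"
    and K: "\<And>x. K differentiable (at x)" "\<beta> > 0" "strongly_convex \<beta> K"
           "L\<^sub>K-lipschitz_on UNIV (grad K)"
    and lmin: "lmin = lambda_min (transpose B ** B)"
    and \<gamma>: "\<gamma> > (sqrt 57 + 1) / (2 * lmin) * (L\<^sub>G + L\<^sub>H)" "\<gamma> > 0"
    and \<sigma>: "0 < \<sigma>" "\<sigma> < 1"
    and algorithm: "napp_al U G J H \<Omega> \<Phi> B K \<gamma> \<sigma> \<delta> \<epsilon> u v p q"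
    and \<delta>: "\<And>k. \<delta> k = \<beta> * inverse
              (L\<^sub>G + norm (q k) * L\<Omega> + \<gamma> * L\<Theta>\<^sup>2
               + 14 * \<gamma> * (spectral_norm B)\<^sup>2 * L\<Theta>\<^sup>2 / lmin
               + 14 * (L\<^sub>G + \<gamma> * spectral_norm B * L\<Theta>)\<^sup>2 / (\<gamma> * lmin) + 1)"
    and w: "\<And>k. w k = (u k, v k, p k)"
    and c\<^sub>1: "c\<^sub>1 = 7 * (L\<^sub>G + \<gamma> * spectral_norm B * L\<Theta>)\<^sup>2 / (\<gamma> * lmin)"
    and c\<^sub>2: "c\<^sub>2 = 7 * (L\<^sub>G + L\<^sub>H)\<^sup>2 / (\<gamma> * lmin)"
    and \<Lambda>: "\<And>k. k \<ge> 1 \<Longrightarrow> \<Lambda> k = aug_lagrangian G J H \<Theta> B \<gamma> (u k, v k, p k)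
              + ereal (c\<^sub>1 * (norm (u (k - 1) - u k))\<^sup>2 + c\<^sub>2 * (norm (v (k - 1) - v k))\<^sup>2
                       + 1 / (2 * \<gamma>) * (norm (p (k - 1) - p k))\<^sup>2)"
  shows "\<exists>\<Lambda>' :: real.
      \<comment> \<open>(i)\<close>
      (\<exists>c::real. \<forall>k\<ge>1. ereal c \<le> \<Lambda> k) \<and> \<Lambda> \<longlonglongrightarrow> ereal \<Lambda>' \<and>
      \<comment> \<open>(ii)\<close>
      bounded (range w) \<and> (\<lambda>k. norm (w k - w (Suc k))) \<longlonglongrightarrow> 0 \<and>
      \<comment> \<open>(iii)\<close>
      (\<lambda>k. aug_lagrangian G J H \<Theta> B \<gamma> (w k)) \<longlonglongrightarrow> ereal \<Lambda>' \<and>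
      (\<lambda>k. objective G J H (u k, v k)) \<longlonglongrightarrow> ereal \<Lambda>' \<and>
      (\<lambda>k. \<Theta> (u k) + B *v v k) \<longlonglongrightarrow> 0 \<and>
      \<comment> \<open>(iv)\<close>
      (\<exists>c\<^sub>5::real. c\<^sub>5 > 0 \<and>
         (\<forall>k. edist_set 0 (subdiff_aug_lagrangian U G J H \<Theta> B \<gamma> (w (Suc k)))
                \<le> ereal (c\<^sub>5 * norm (w k - w (Suc k))))) \<and>
      (\<lambda>k. edist_set 0 (subdiff_aug_lagrangian U G J H \<Theta> B \<gamma> (w k))) \<longlonglongrightarrow> 0 \<and>
      \<comment> \<open>(v)\<close>
      (\<forall>w'. cluster_point w w' \<longrightarrow>
         stationary_point U G J H \<Theta> B \<gamma> w' \<and> aug_lagrangian G J H \<Theta> B \<gamma> w' = ereal \<Lambda>')"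
proof -
  have B_inj: "inj ((*v) B)" using H6(2) by (simp add: full_rank_injective)
  interpret napp_al_run U G J H \<Omega> \<Phi> \<Theta> B K L\<^sub>G L\<^sub>H L\<Theta> L\<Omega> L\<^sub>K \<beta> \<gamma> \<sigma> lmin L\<Omega>c \<delta> \<epsilon> u v p q
    by unfold_locales (fact B_inj U \<Theta>_def \<Omega>_diff \<Phi>_diff H1 H2 H3 H4 H5 H6 H7 K lmin \<gamma> \<sigma> algorithm \<delta>)+
  define D where "D = (\<lambda>k. norm (w k - w (Suc k)))"
  obtain l where l: "Psi \<longlonglongrightarrow> l" using step_limits(4) by (auto simp: convergent_def)
  have AL: "aug_lagrangian G J H \<Theta> B \<gamma> (u (Suc k), v (Suc k), p (Suc k))
      = ereal (Lr (u (Suc k)) (v (Suc k)) (p (Suc k)))" for k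
    by (rule aug_lagrangian_eq[OF J_finite])
  have \<Lambda>_Suc: "\<Lambda> (Suc k) = ereal (Lr (u (Suc k)) (v (Suc k)) (p (Suc k))
      + (c\<^sub>1 * (du k)\<^sup>2 + c\<^sub>2 * (dv k)\<^sup>2 + 1 / (2 * \<gamma>) * (norm (p (Suc k) - p k))\<^sup>2))" for k
    by (simp add: \<Lambda> AL norm_minus_commute)
  have c: "3 * (m\<^sup>2 / (\<gamma> * lmin)) \<le> c\<^sub>1" "3 * (s\<^sup>2 / (\<gamma> * lmin)) \<le> c\<^sub>2"
    using gamma_lmin_pos by (auto simp: c\<^sub>1 c\<^sub>2 divide_right_mono)
  have i1: "\<exists>c::real. \<forall>k\<ge>1. ereal c \<le> \<Lambda> k"
  proof -
    obtain c where c': "\<forall>k. c \<le> Psi k" using Psi_bounded_below by blast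
    have "ereal c \<le> \<Lambda> (Suc k)" for k
    proof -
      \<comment> \<open>The larger constants put \<open>\<Lambda> (Suc k)\<close> above
        \<open>Psi k\<close>, so it inherits the lower bound.\<close>
      have "Psi k \<le> Lr (u (Suc k)) (v (Suc k)) (p (Suc k)) + c\<^sub>1 * (du k)\<^sup>2 + c\<^sub>2 * (dv k)\<^sup>2"
        unfolding Psi_def by (intro add_mono mult_right_mono c order_refl zero_le_power2)
      moreover have "0 \<le> 1 / (2 * \<gamma>) * (norm (p (Suc k) - p k))\<^sup>2" using \<gamma>(2) by simp
      ultimately show ?thesis using spec[OF c', of k] unfolding \<Lambda>_Suc ereal_less_eq by linarith
    qed
    then show ?thesis by (intro exI[of _ c]) (metis Suc_le_D One_nat_def)
  qed
  have i2: "\<Lambda> \<longlonglongrightarrow> ereal l"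
  proof -
    have "(\<lambda>k. Lr (u (Suc k)) (v (Suc k)) (p (Suc k))
        + (c\<^sub>1 * (du k)\<^sup>2 + c\<^sub>2 * (dv k)\<^sup>2 + 1 / (2 * \<gamma>) * (norm (p (Suc k) - p k))\<^sup>2))
      \<longlonglongrightarrow> l + (c\<^sub>1 * 0\<^sup>2 + c\<^sub>2 * 0\<^sup>2 + 1 / (2 * \<gamma>) * 0\<^sup>2)"
      by (intro tendsto_add tendsto_mult tendsto_power tendsto_const Lr_limit[OF l] step_limits)
    then have "(\<lambda>k. \<Lambda> (Suc k)) \<longlonglongrightarrow> ereal l" by (simp add: \<Lambda>_Suc)
    \<comment> \<open>\<open>\<Lambda> 0\<close> is unspecified, so the limit is taken from index
      one.\<close>
    then show ?thesis by (rule LIMSEQ_imp_Suc)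
  qed
  have ii1: "bounded (range w)"
  proof (rule bounded_subset)
    show "bounded (range u \<times> range v \<times> range p)" by (intro bounded_Times bounded_uv bounded_p)
  qed (auto simp: w)
  have ii2: "D \<longlonglongrightarrow> 0"
  proof (rule Lim_null_comparison)
    show "(\<lambda>k. du k + (dv k + norm (p (Suc k) - p k))) \<longlonglongrightarrow> 0"
      using tendsto_add[OF step_limits(1) tendsto_add[OF step_limits(2) step_limits(3)]] by simp
    have "D k \<le> du k + (dv k + norm (p (Suc k) - p k))" for k
      using norm_Pair_le[of "u k - u (Suc k)" "(v k - v (Suc k), p k - p (Suc k))"]
        norm_Pair_le[of "v k - v (Suc k)" "p k - p (Suc k)"]
      by (simp add: D_def w norm_minus_commute)
    then show "\<forall>\<^sub>F k in sequentially. norm (D k) \<le> du k + (dv k + norm (p (Suc k) - p k))"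
      by (simp add: D_def)
  qed
  have iii1: "(\<lambda>k. aug_lagrangian G J H \<Theta> B \<gamma> (w k)) \<longlonglongrightarrow> ereal l"
    by (rule LIMSEQ_imp_Suc) (simp add: w AL Lr_limit[OF l])
  have iii3: "(\<lambda>k. \<Theta> (u k) + B *v v k) \<longlonglongrightarrow> 0" using res_limit by (simp add: res_def[abs_def])
  obtain c\<^sub>5 where c5: "c\<^sub>5 > 0"
    "\<And>k. edist_set 0 (subdiff_aug_lagrangian U G J H \<Theta> B \<gamma> (w (Suc k))) \<le> ereal (c\<^sub>5 * D k)"
    using subdifferential_residual unfolding w D_def by blast
  have iv2: "(\<lambda>k. edist_set 0 (subdiff_aug_lagrangian U G J H \<Theta> B \<gamma> (w k))) \<longlonglongrightarrow> 0"
  proof (rule LIMSEQ_imp_Suc, rule tendsto_sandwich[where f = "\<lambda>_. 0" and h = "\<lambda>k. ereal (c\<^sub>5 * D k)"])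
    have "(\<lambda>k. ereal (c\<^sub>5 * D k)) \<longlonglongrightarrow> ereal (c\<^sub>5 * 0)" by (intro tendsto_intros ii2)
    then show "(\<lambda>k. ereal (c\<^sub>5 * D k)) \<longlonglongrightarrow> 0" by (simp add: zero_ereal_def)
    show "\<forall>\<^sub>F k in sequentially. 0 \<le> edist_set 0 (subdiff_aug_lagrangian U G J H \<Theta> B \<gamma> (w (Suc k)))"
      by (auto simp: edist_set_def intro!: always_eventually INF_greatest)
    show "\<forall>\<^sub>F k in sequentially. edist_set 0 (subdiff_aug_lagrangian U G J H \<Theta> B \<gamma> (w (Suc k))) \<le> ereal (c\<^sub>5 * D k)"
      by (intro always_eventually allI c5)
  qed simp
  have v: "stationary_point U G J H \<Theta> B \<gamma> w' \<and> aug_lagrangian G J H \<Theta> B \<gamma> w' = ereal l"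
    if cluster: "cluster_point w w'" for w'
  proof -
    obtain x y z where w': "w' = (x, y, z)" by (cases w')
    obtain r where r: "strict_mono r" and lim: "(\<lambda>n. w (r n)) \<longlonglongrightarrow> w'"
      using cluster by (auto simp: cluster_point_def o_def)
    \<comment> \<open>The cluster point lemmas expect indices of the form \<open>Suc (r' n)\<close>.
      Dropping the first term guarantees \<open>r (Suc n) \<ge> 1\<close>, so the subtraction does
      not truncate.\<close>
    define r' where "r' n = r (Suc n) - 1" for n
    have r': "Suc (r' n) = r (Suc n)" for n
      using seq_suble[OF r, of "Suc n"] by (simp add: r'_def)
    have "strict_mono r'"
    proof (rule strict_mono_Suc_iff[THEN iffD2], rule allI)
      fix n
      have "r (Suc n) < r (Suc (Suc n))" using r by (simp add: strict_mono_Suc_iff)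
      then show "r' n < r' (Suc n)" using r'[of n] r'[of "Suc n"] by linarith
    qed
    moreover have "(\<lambda>n. w (Suc (r' n))) \<longlonglongrightarrow> (x, y, z)"
      using LIMSEQ_Suc[OF lim] by (simp add: r' w')
    then have L: "(\<lambda>n. (u (Suc (r' n)), v (Suc (r' n)), p (Suc (r' n)))) \<longlonglongrightarrow> (x, y, z)"
      unfolding w .
    have "(\<lambda>n. u (Suc (r' n))) \<longlonglongrightarrow> x" "(\<lambda>n. v (Suc (r' n))) \<longlonglongrightarrow> y" "(\<lambda>n. p (Suc (r' n))) \<longlonglongrightarrow> z"
      using tendsto_fst[OF L] tendsto_fst[OF tendsto_snd[OF L]] tendsto_snd[OF tendsto_snd[OF L]] by simp_all
    ultimately show ?thesis
      unfolding w' by (intro conjI cluster_point_stationary(1) cluster_point_value[OF l])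
  qed
  show ?thesis
    using i1 i2 ii1 ii2 iii1 objective_limit[OF l] iii3 c5 iv2 v unfolding D_def by blast
qed

end
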